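(* The map $\Phi: \mathbb{P}_{m} \times \mathbb{P}_{m} \to \mathbb{R}$ defined by $$\Phi(A, B) = \operatorname{tr}\left[A \nabla_{t} B - F_{t}(A, B)\right]$$ is a quantum divergence for $t \in [0,1]$.
   Context: $\mathbb{P}_{m}$ denotes the set of $m \times m$ complex (Hermitian) positive definite matrices. Real powers of positive definite matrices are defined by functional calculus. For $A,B\in\mathbb{P}_m$ and $t\in[0,1]$: $A \nabla_{t} B := (1-t) A + t B$; $A \sharp_{t} B := A^{1/2} (A^{-1/2} B A^{-1/2})^{t} A^{1/2}$; $F_{t}(A, B) := (A^{-1} \sharp_{t} B)^{1/2} A^{2-2t} (A^{-1} \sharp_{t} B)^{1/2}$. A map $\Phi : \mathbb{P}_m \times \mathbb{P}_m \to \mathbb{R}$ is called a quantum divergence if it satisfies: (I) $\Phi(A, B) \geq 0$, and equality holds if and only if $A = B$; (II) the derivative $D\Phi$ of $\Phi$ with respect to the second variable vanishes on the diagonal, that is, $D \Phi(A, B) |_{B=A} = 0$; (III) the second derivative (with respect to the second variable) is non-negative on the diagonal, that is, $D^{2} \Phi(A, B) |_{B=A} [Y,Y] \geq 0$ for any Hermitian $m\times m$ matrix $Y$.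
   Formalization: At t = 0 and t = 1 the map Φ is identically 0, so "Φ(A,B) = 0 only if A = B" fails there; that implication is proved only for 0 < t < 1, while Φ ≥ 0, Φ(A,A) = 0, (II) and (III) are proved for all t in [0,1]. *)

theory Defs
  imports "HOL-Analysis.Analysis"
begin

definition cadjoint :: "complex^'n^'m \<Rightarrow> complex^'m^'n" where
  "cadjoint A = (\<chi> i j. cnj (A $ j $ i))"

definition hermitian :: "complex^'n^'n \<Rightarrow> bool" where
  "hermitian A \<longleftrightarrow> cadjoint A = A"

definition unitary :: "complex^'n^'n \<Rightarrow> bool" where
  "unitary U \<longleftrightarrow> cadjoint U ** U = mat 1 \<and> U ** cadjoint U = mat 1"

(* The quadratic form of a Hermitian matrix is real-valued, so taking Re loses nothing. *)
definition posdef :: "(complex^'n^'n) set" where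
  "posdef = {A. hermitian A \<and>
     (\<forall>x. x \<noteq> 0 \<longrightarrow> Re (\<Sum>i\<in>UNIV. cnj (x $ i) * (A *v x) $ i) > 0)}"

definition real_diag :: "('n \<Rightarrow> real) \<Rightarrow> complex^'n^'n" where
  "real_diag d = (\<chi> i j. if i = j then complex_of_real (d i) else 0)"

(* Functional calculus f(U diag(d) U* ) = U diag(f(d)) U*. For Hermitian A such a
   decomposition exists by the spectral theorem, and the result does not depend on its choice. *)
definition matrix_fun :: "(real \<Rightarrow> real) \<Rightarrow> complex^'n^'n \<Rightarrow> complex^'n^'n" where
  "matrix_fun f A = (THE X. \<exists>U d. unitary U \<and> A = U ** real_diag d ** cadjoint U \<and>
     X = U ** real_diag (\<lambda>i. f (d i)) ** cadjoint U)"

definition mpow :: "complex^'n^'n \<Rightarrow> real \<Rightarrow> complex^'n^'n" where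
  "mpow A r = matrix_fun (\<lambda>x. x powr r) A"

definition arith_mean :: "real \<Rightarrow> complex^'n^'n \<Rightarrow> complex^'n^'n \<Rightarrow> complex^'n^'n" where
  "arith_mean t A B = (1 - t) *\<^sub>R A + t *\<^sub>R B"

definition geo_mean :: "real \<Rightarrow> complex^'n^'n \<Rightarrow> complex^'n^'n \<Rightarrow> complex^'n^'n" where
  "geo_mean t A B =
     mpow A (1/2) ** mpow (mpow A (-1/2) ** B ** mpow A (-1/2)) t ** mpow A (1/2)"

definition F_mean :: "real \<Rightarrow> complex^'n^'n \<Rightarrow> complex^'n^'n \<Rightarrow> complex^'n^'n" where
  "F_mean t A B =
     mpow (geo_mean t (matrix_inv A) B) (1/2) ** mpow A (2 - 2 * t)
       ** mpow (geo_mean t (matrix_inv A) B) (1/2)"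

(* The trace is that of a Hermitian matrix when A and B are positive definite, hence real.
   For t = 0 and t = 1 the matrix under the trace is 0, so there Phi_div vanishes identically
   and does not separate points; only for 0 < t < 1 can it be a quantum divergence. *)
definition Phi_div :: "real \<Rightarrow> complex^'n^'n \<Rightarrow> complex^'n^'n \<Rightarrow> real" where
  "Phi_div t A B = Re (trace (arith_mean t A B - F_mean t A B))"

(* D2 is a second Frechet derivative of f at a relative to S: f is differentiable on S near a,
   and its derivative D is differentiable at a. For S = posdef, which is open in the real
   space of Hermitian matrices, D2 is uniquely determined on pairs of Hermitian matrices, and
   only there. *)
definition has_second_derivative_within ::
    "('a::real_normed_vector \<Rightarrow> real) \<Rightarrow> ('a \<Rightarrow>\<^sub>L 'a \<Rightarrow>\<^sub>L real) \<Rightarrow> 'a \<Rightarrow> 'a set \<Rightarrow> bool" where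
  "has_second_derivative_within f D2 a S \<longleftrightarrow>
     (\<exists>D :: 'a \<Rightarrow> 'a \<Rightarrow>\<^sub>L real.
        (\<forall>\<^sub>F x in nhds a. x \<in> S \<longrightarrow> (f has_derivative blinfun_apply (D x)) (at x within S)) \<and>
        (D has_derivative blinfun_apply D2) (at a within S))"

definition separates_pos :: "(complex^'n^'n \<Rightarrow> complex^'n^'n \<Rightarrow> real) \<Rightarrow> bool" where
  "separates_pos \<Phi> \<longleftrightarrow>
     (\<forall>A\<in>posdef. \<forall>B\<in>posdef. \<Phi> A B \<ge> 0 \<and> (\<Phi> A B = 0 \<longleftrightarrow> A = B))"

definition deriv_vanishes_diag :: "(complex^'n^'n \<Rightarrow> complex^'n^'n \<Rightarrow> real) \<Rightarrow> bool" where
  "deriv_vanishes_diag \<Phi> \<longleftrightarrow>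
     (\<forall>A\<in>posdef. ((\<lambda>B. \<Phi> A B) has_derivative (\<lambda>_. 0)) (at A within posdef))"

definition second_deriv_nonneg_diag :: "(complex^'n^'n \<Rightarrow> complex^'n^'n \<Rightarrow> real) \<Rightarrow> bool" where
  "second_deriv_nonneg_diag \<Phi> \<longleftrightarrow>
     (\<forall>A\<in>posdef. \<exists>D2. has_second_derivative_within (\<lambda>B. \<Phi> A B) D2 A posdef \<and>
        (\<forall>Y. hermitian Y \<longrightarrow> blinfun_apply (blinfun_apply D2 Y) Y \<ge> 0))"

definition quantum_divergence :: "(complex^'n^'n \<Rightarrow> complex^'n^'n \<Rightarrow> real) \<Rightarrow> bool" where
  "quantum_divergence \<Phi> \<longleftrightarrow>
     separates_pos \<Phi> \<and> deriv_vanishes_diag \<Phi> \<and> second_deriv_nonneg_diag \<Phi>"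

end

theory Submission
  imports Defs
begin

text \<open>
  The proof diagonalizes. Put \<open>C = A^(1/2) B A^(1/2)\<close>. Cyclicity of the trace turns \<open>tr F\<^sub>t(A, B)\<close> into
  \<open>tr (A^(1 - 2t) C^t)\<close> (lemma \<open>Phi_div_eq\<close>) and \<open>tr B\<close> into \<open>tr (A^(-1) C)\<close>. If \<open>A\<close> has eigenvalues \<open>a\<^sub>i\<close>
  with eigenbasis \<open>u\<^sub>i\<close>, and \<open>C\<close> has eigenvalues \<open>c\<^sub>j\<close> with eigenbasis \<open>v\<^sub>j\<close>, then \<open>tr (f(A) g(C))\<close> is
  the sum of \<open>f(a\<^sub>i) g(c\<^sub>j) w\<^sub>i\<^sub>j\<close> with the weights \<open>w\<^sub>i\<^sub>j = |<u\<^sub>i, v\<^sub>j>|\<^sup>2\<close>. Hence (lemma \<open>Phi_div_expansion\<close>)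
  the divergence is the sum of the scalar terms
  \<open>(1 - t) a\<^sub>i + t (c\<^sub>j / a\<^sub>i) - a\<^sub>i^(1 - t) (c\<^sub>j / a\<^sub>i)^t\<close> with weights \<open>w\<^sub>i\<^sub>j\<close>. Each term is nonnegative by
  Young's inequality. For \<open>0 < t < 1\<close> the sum vanishes only if \<open>c\<^sub>j = a\<^sub>i\<^sup>2\<close> whenever \<open>w\<^sub>i\<^sub>j\<close> is nonzero,
  which says \<open>C = A^2\<close>, that is, \<open>A = B\<close>.

  The two conditions on derivatives need no formula for the derivatives. Since \<open>\<Phi>(A, _)\<close> is nonnegative
  and vanishes at \<open>A\<close>, it has a minimum there, and a positive definite matrix stays positive definite
  when it is moved a little in a Hermitian direction; so the usual necessary conditions for a minimum
  give both claims, for every \<open>t\<close> in \<open>[0, 1]\<close>, once \<open>\<Phi>(A, _)\<close> is known to be twice differentiable. The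
  only nonlinear part is \<open>C \<mapsto> C^t\<close>. Near a given positive definite matrix it is a binomial series
  in \<open>C / s - 1\<close> for a large enough scalar \<open>s\<close>, because there \<open>C / s - 1\<close> is a contraction with a uniform
  constant below 1; the series is differentiated twice term by term
  (lemma \<open>mpow_locally_twice_differentiable\<close>).
\<close>

section \<open>Unitary diagonalization and functional calculus\<close>

lemma Re_sum_cnj_mult_eq_inner: "Re (\<Sum>i\<in>UNIV. cnj (x $ i) * y $ i) = x \<bullet> (y :: complex^'n)"
  by (simp add: inner_vec_def inner_complex_def)

lemma posdef_iff_inner: "A \<in> posdef \<longleftrightarrow> hermitian A \<and> (\<forall>x. x \<noteq> 0 \<longrightarrow> x \<bullet> (A *v x) > 0)"
  by (simp add: posdef_def Re_sum_cnj_mult_eq_inner del: Re_sum)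

lemma cadjoint_cadjoint [simp]: "cadjoint (cadjoint A) = A"
  by (simp add: cadjoint_def vec_eq_iff)

lemma cadjoint_mult: "cadjoint (A ** B) = cadjoint B ** cadjoint A"
  by (simp add: cadjoint_def matrix_matrix_mult_def vec_eq_iff mult.commute)

lemma cadjoint_real_diag [simp]: "cadjoint (real_diag d) = real_diag d"
  by (auto simp: cadjoint_def real_diag_def vec_eq_iff)

lemma inner_cadjoint: "x \<bullet> (A *v y) = (cadjoint A *v x) \<bullet> y"
proof -
  have "(\<Sum>i\<in>UNIV. cnj (x $ i) * (A *v y) $ i) = (\<Sum>i\<in>UNIV. cnj ((cadjoint A *v x) $ i) * y $ i)"
    unfolding matrix_vector_mult_def cadjoint_def
    by (simp add: sum_distrib_left sum_distrib_right) (subst sum.swap, simp add: ac_simps)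
  from arg_cong[OF this, of Re] show ?thesis
    by (simp only: Re_sum_cnj_mult_eq_inner)
qed

lemma real_diag_mult_nth: "(real_diag a ** W) $ i $ j = of_real (a i) * W $ i $ j"
proof -
  have "(real_diag a ** W) $ i $ j = (\<Sum>k\<in>UNIV. if k = i then of_real (a i) * W $ i $ j else 0)"
    by (simp only: real_diag_def matrix_matrix_mult_def vec_lambda_beta) (rule sum.cong, auto)
  then show ?thesis by simp
qed

lemma mult_real_diag_nth: "(W ** real_diag a) $ i $ j = W $ i $ j * of_real (a j)"
proof -
  have "(W ** real_diag a) $ i $ j = (\<Sum>k\<in>UNIV. if k = j then W $ i $ j * of_real (a j) else 0)"
    by (simp only: real_diag_def matrix_matrix_mult_def vec_lambda_beta) (rule sum.cong, auto)
  then show ?thesis by simp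
qed

lemma real_diag_mult_vec_nth: "(real_diag a *v x) $ i = of_real (a i) * x $ i"
proof -
  have "(real_diag a *v x) $ i = (\<Sum>k\<in>UNIV. if k = i then of_real (a i) * x $ i else 0)"
    by (simp only: real_diag_def matrix_vector_mult_def vec_lambda_beta) (rule sum.cong, auto)
  then show ?thesis by simp
qed

lemma real_diag_mult: "real_diag a ** real_diag b = real_diag (\<lambda>i. a i * b i)"
  by (simp add: vec_eq_iff real_diag_mult_nth) (simp add: real_diag_def)

lemma real_diag_1: "real_diag (\<lambda>i. 1) = mat 1"
  by (simp add: real_diag_def mat_def vec_eq_iff)

definition udiag :: "complex^'n^'n \<Rightarrow> ('n \<Rightarrow> real) \<Rightarrow> complex^'n^'n" where
  "udiag U d = U ** real_diag d ** cadjoint U"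

lemma unitary_cancel:
  assumes "unitary U"
  shows "cadjoint U ** U = mat 1" "U ** cadjoint U = mat 1"
    "cadjoint U ** (U ** X) = X" "U ** (cadjoint U ** X) = X"
  using assms by (simp_all add: unitary_def matrix_mul_assoc)

lemma hermitian_udiag: "hermitian (udiag U d)"
  by (simp add: hermitian_def udiag_def cadjoint_mult matrix_mul_assoc)

lemma udiag_mult: "unitary U \<Longrightarrow> udiag U a ** udiag U b = udiag U (\<lambda>i. a i * b i)"
  unfolding udiag_def by (simp add: unitary_cancel matrix_mul_assoc[symmetric] flip: real_diag_mult)

lemma udiag_1: "unitary U \<Longrightarrow> udiag U (\<lambda>i. 1) = mat 1"
  unfolding udiag_def by (simp add: real_diag_1 unitary_cancel)

lemma udiag_nth: "udiag U d $ i $ j = (\<Sum>k\<in>UNIV. d k *\<^sub>R (U $ i $ k * cnj (U $ j $ k)))"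
  unfolding udiag_def matrix_matrix_mult_def[of _ "cadjoint U"]
  by (simp add: mult_real_diag_nth cadjoint_def scaleR_conv_of_real ac_simps)

lemma udiag_diff: "udiag U a - udiag U b = udiag U (\<lambda>i. a i - b i)"
  by (simp add: vec_eq_iff udiag_nth sum_subtractf scaleR_diff_left)

lemma scaleR_udiag: "r *\<^sub>R udiag U a = udiag U (\<lambda>i. r * a i)"
  by (simp add: vec_eq_iff udiag_nth scaleR_sum_right)

text \<open>
  With \<open>W = U* V\<close> the equation reads \<open>diag(a) W = W diag(c)\<close>, which can be compared entry by entry.
  This serves twice: it makes the functional calculus well defined, and it recovers \<open>C = A^2\<close> from a
  relation between eigenvalues.
\<close>

lemma udiag_eq_iff:
  assumes "unitary U" "unitary V"
  shows "udiag U a = udiag V c \<longleftrightarrow> (\<forall>i j. (cadjoint U ** V) $ i $ j \<noteq> 0 \<longrightarrow> a i = c j)"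
proof -
  let ?W = "cadjoint U ** V"
  have "udiag U a = udiag V c \<longleftrightarrow> real_diag a ** ?W = ?W ** real_diag c"
  proof
    assume eq: "udiag U a = udiag V c"
    have "real_diag a ** ?W = cadjoint U ** udiag U a ** V"
      using assms by (simp add: udiag_def unitary_cancel matrix_mul_assoc[symmetric])
    also have "\<dots> = ?W ** real_diag c"
      using assms by (simp add: eq) (simp add: udiag_def unitary_cancel matrix_mul_assoc[symmetric])
    finally show "real_diag a ** ?W = ?W ** real_diag c" .
  next
    assume eq: "real_diag a ** ?W = ?W ** real_diag c"
    have "udiag U a = U ** (real_diag a ** ?W) ** cadjoint V"
      using assms by (simp add: udiag_def unitary_cancel matrix_mul_assoc[symmetric])
    also have "\<dots> = udiag V c"
      using assms by (simp add: eq) (simp add: udiag_def unitary_cancel matrix_mul_assoc[symmetric])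
    finally show "udiag U a = udiag V c" .
  qed
  also have "\<dots> \<longleftrightarrow> (\<forall>i j. ?W $ i $ j \<noteq> 0 \<longrightarrow> a i = c j)"
    by (auto simp: vec_eq_iff[of "real_diag a ** ?W"] vec_eq_iff[of "(real_diag a ** ?W) $ _"]
        real_diag_mult_nth mult_real_diag_nth)
  finally show ?thesis .
qed

text \<open>
  The entrywise criterion for equality is preserved when a function is applied to both families of
  eigenvalues, so the result is independent of the diagonalization and the definite description
  has a unique solution.
\<close>

lemma matrix_fun_udiag:
  assumes "unitary U"
  shows "matrix_fun f (udiag U d) = udiag U (\<lambda>i. f (d i))"
  unfolding matrix_fun_def udiag_def[symmetric]
proof (rule the_equality)
  show "\<exists>V c. unitary V \<and> udiag U d = udiag V c \<and> udiag U (\<lambda>i. f (d i)) = udiag V (\<lambda>i. f (c i))"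
    using assms by blast
next
  fix X assume "\<exists>V c. unitary V \<and> udiag U d = udiag V c \<and> X = udiag V (\<lambda>i. f (c i))"
  then obtain V c where V: "unitary V" "udiag U d = udiag V c" "X = udiag V (\<lambda>i. f (c i))" by blast
  then have "udiag U (\<lambda>i. f (d i)) = udiag V (\<lambda>i. f (c i))"
    using assms by (simp add: udiag_eq_iff)
  then show "X = udiag U (\<lambda>i. f (d i))" using V by simp
qed

text \<open>
  The weights are the squared moduli of the inner products of the two eigenbases. They do not depend
  on \<open>a\<close> and \<open>c\<close>, so traces of products of functions of two matrices can be compared
  summand by summand; the constant function 1 brings the trace of a single matrix into the same form.
\<close>

lemma trace_udiag_mult:
  assumes "unitary U" "unitary V"
  shows "Re (trace (udiag U a ** udiag V c)) =
    (\<Sum>i\<in>UNIV. \<Sum>j\<in>UNIV. a i * c j * (norm ((cadjoint U ** V) $ i $ j))\<^sup>2)"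
proof -
  let ?W = "cadjoint U ** V"
  have "trace (udiag U a ** udiag V c) = trace (U ** (real_diag a ** ?W ** real_diag c ** cadjoint V))"
    by (simp add: udiag_def matrix_mul_assoc)
  also have "\<dots> = trace (real_diag a ** ?W ** real_diag c ** cadjoint V ** U)"
    by (rule trace_mul_sym)
  also have "\<dots> = trace ((real_diag a ** ?W) ** (real_diag c ** cadjoint ?W))"
    by (simp add: cadjoint_mult matrix_mul_assoc)
  also have "\<dots> = (\<Sum>i\<in>UNIV. \<Sum>j\<in>UNIV. of_real (a i) * ?W $ i $ j * (of_real (c j) * cnj (?W $ i $ j)))"
    by (simp add: trace_def matrix_matrix_mult_def[of "real_diag a ** ?W"] real_diag_mult_nth
        cadjoint_def[of ?W])
  also have "\<dots> = (\<Sum>i\<in>UNIV. \<Sum>j\<in>UNIV. of_real (a i * c j * (norm (?W $ i $ j))\<^sup>2))"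
    by (intro sum.cong refl) (simp only: of_real_mult complex_norm_square ac_simps)
  finally show ?thesis by simp
qed

lemma inner_udiag:
  "x \<bullet> (udiag U d *v x) = (\<Sum>i\<in>UNIV. d i * (norm ((cadjoint U *v x) $ i))\<^sup>2)"
proof -
  have "x \<bullet> (udiag U d *v x) = (cadjoint U *v x) \<bullet> (real_diag d *v (cadjoint U *v x))"
    by (simp add: udiag_def inner_cadjoint[of x U] flip: matrix_vector_mul_assoc)
  also have "\<dots> = (\<Sum>i\<in>UNIV. d i * (norm ((cadjoint U *v x) $ i))\<^sup>2)"
    by (simp add: inner_vec_def real_diag_mult_vec_nth power2_norm_eq_inner
        inner_complex_def algebra_simps)
  finally show ?thesis .
qed

lemma unitary_vec_eq_0: "unitary U \<Longrightarrow> cadjoint U *v x = 0 \<longleftrightarrow> x = 0"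
  by (metis matrix_vector_mul_assoc matrix_vector_mul_lid matrix_vector_mult_0_right unitary_def)

lemma norm_unitary: "unitary U \<Longrightarrow> norm (cadjoint U *v x) = norm x"
  by (simp add: norm_eq_sqrt_inner inner_cadjoint matrix_vector_mul_assoc unitary_def)

lemma matrix_vector_mult_scaleR: "(A :: complex^'n^'m) *v (r *\<^sub>R x) = r *\<^sub>R (A *v x)"
  by (simp add: vec_eq_iff matrix_vector_mult_def scaleR_sum_right)

lemma scaleR_matrix_vector_mult: "(r *\<^sub>R (A :: complex^'n^'m)) *v x = r *\<^sub>R (A *v x)"
  by (simp add: vec_eq_iff matrix_vector_mult_def scaleR_sum_right)

lemma linear_mult_vec: "linear ((*v) (A :: complex^'n^'m))"
  by (intro linearI matrix_vector_right_distrib matrix_vector_mult_scaleR)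

lemma udiag_eigenvector:
  assumes "unitary U" shows "udiag U d *v (U *v axis i 1) = d i *\<^sub>R (U *v axis i 1)"
proof -
  have "udiag U d *v (U *v axis i 1) = U *v (real_diag d *v axis i 1)"
    using assms by (simp add: udiag_def matrix_vector_mul_assoc matrix_mul_assoc[symmetric] unitary_cancel)
  also have "real_diag d *v axis i 1 = d i *\<^sub>R axis i 1"
    by (auto simp: vec_eq_iff real_diag_mult_vec_nth axis_def complex_eq_iff)
  finally show ?thesis by (simp add: matrix_vector_mult_scaleR)
qed

lemma posdef_udiag_iff:
  assumes "unitary U" shows "udiag U d \<in> posdef \<longleftrightarrow> (\<forall>i. d i > 0)"
proof
  assume "udiag U d \<in> posdef"
  show "\<forall>i. d i > 0"
  proof
    fix i
    let ?x = "U *v axis i 1"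
    have "cadjoint U *v ?x = axis i 1" using assms by (simp add: matrix_vector_mul_assoc unitary_cancel)
    then have "?x \<noteq> 0" using axis_eq_0_iff[of i "1::complex"] by force
    then have "0 < ?x \<bullet> (udiag U d *v ?x)"
      using \<open>udiag U d \<in> posdef\<close> unfolding posdef_iff_inner by blast
    then show "0 < d i"
      using inner_ge_zero[of ?x]
        by (auto simp: udiag_eigenvector[OF assms] zero_less_mult_iff simp del: inner_ge_zero)
  qed
next
  assume d: "\<forall>i. d i > 0"
  have "0 < x \<bullet> (udiag U d *v x)" if x: "x \<noteq> 0" for x
  proof -
    obtain i where "(cadjoint U *v x) $ i \<noteq> 0"
      using unitary_vec_eq_0[OF assms, of x] x by (metis vec_eq_iff zero_index)
    then show ?thesis unfolding inner_udiag using d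
      by (intro sum_pos2[of _ i]) (auto simp: less_imp_le)
  qed
  then show "udiag U d \<in> posdef" by (simp add: posdef_iff_inner hermitian_udiag)
qed

section \<open>The spectral theorem for Hermitian matrices\<close>

definition cinner :: "complex^'n \<Rightarrow> complex^'n \<Rightarrow> complex" where
  "cinner x y = (\<Sum>i\<in>UNIV. cnj (x $ i) * y $ i)"

lemma Re_cinner: "Re (cinner x y) = x \<bullet> y"
  unfolding cinner_def by (rule Re_sum_cnj_mult_eq_inner)

lemma cinner_self: "cinner x x = of_real ((norm x)\<^sup>2)"
proof -
  have "cinner x x = of_real (\<Sum>i\<in>UNIV. (norm (x $ i))\<^sup>2)"
    unfolding cinner_def of_real_sum by (intro sum.cong refl) (simp only: complex_norm_square mult.commute)
  then have "cinner x x = of_real (Re (cinner x x))"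
    by (simp only: Re_complex_of_real)
  then show ?thesis by (simp only: Re_cinner power2_norm_eq_inner)
qed

lemma cinner_commute: "cinner y x = cnj (cinner x y)"
  by (simp add: cinner_def mult.commute)

lemma cinner_cadjoint: "cinner x (A *v y) = cinner (cadjoint A *v x) y"
  unfolding cinner_def matrix_vector_mult_def cadjoint_def
  by (simp add: sum_distrib_left sum_distrib_right) (subst sum.swap, simp add: ac_simps)

lemma cinner_add_right: "cinner x (y + z) = cinner x y + cinner x z"
  by (simp add: cinner_def sum.distrib ring_distribs)

lemma cinner_scaleR_right: "cinner x (r *\<^sub>R y) = r *\<^sub>R cinner x y"
  by (simp add: cinner_def scaleR_sum_right)

lemma cinner_scaleR_left: "cinner (r *\<^sub>R x) y = r *\<^sub>R cinner x y"
  by (simp add: cinner_def scaleR_sum_right)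

lemma continuous_on_cinner: "continuous_on S (cinner x)"
  unfolding cinner_def by (intro continuous_intros)

text \<open>
  The vectors \<open>u i\<close> with \<open>i\<close> in \<open>I\<close>, conjugated, are taken as rows of a square matrix whose other rows are 0.
  Row \<open>k\<close> is then 0, so the matrix is singular, and any nonzero vector of its kernel does.
\<close>

lemma exists_orthogonal_vector:
  fixes u :: "'n \<Rightarrow> complex^'n"
  assumes "k \<notin> I"
  shows "\<exists>w. w \<noteq> 0 \<and> (\<forall>i\<in>I. cinner (u i) w = 0)"
proof -
  define M :: "complex^'n^'n" where "M = (\<chi> i. if i \<in> I then (\<chi> j. cnj (u i $ j)) else 0)"
  have "row k M = 0" using assms by (simp add: M_def row_def vec_eq_iff)
  then have "\<not> invertible M" by (simp add: invertible_det_nz det_zero_row(2))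
  then have "\<not> (\<exists>B. B ** M = mat 1)" using invertible_left_inverse by blast
  then obtain w where w: "M *v w = 0" "w \<noteq> 0"
    unfolding matrix_left_invertible_ker by blast
  have "cinner (u i) w = 0" if "i \<in> I" for i
  proof -
    have "(M *v w) $ i = cinner (u i) w"
      using that by (simp add: M_def matrix_vector_mult_def cinner_def)
    then show ?thesis using w by simp
  qed
  then show ?thesis using w(2) by blast
qed

lemma hermitian_inner:
  assumes "hermitian A" shows "x \<bullet> (A *v y) = (A *v x) \<bullet> y"
  using inner_cadjoint[of x A y] assms by (simp add: hermitian_def)

text \<open>
  A maximizer \<open>x\<close> of the quadratic form on the unit sphere of \<open>W\<close>, with maximum \<open>l\<close>, is an eigenvector:
  the form of \<open>l - A\<close> is nonnegative on \<open>W\<close> and vanishes at \<open>x\<close>, so its first variation at \<open>x\<close> in the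
  direction \<open>z = l x - A x\<close>, which is twice \<open>z \<bullet> z\<close>, must vanish.
\<close>

lemma hermitian_max_eigenvector:
  fixes A :: "complex^'n^'n"
  assumes A: "hermitian A" and W: "subspace W" "closed W" "\<And>x. x \<in> W \<Longrightarrow> A *v x \<in> W"
    and ne: "w \<in> W" "w \<noteq> 0"
  shows "\<exists>x\<in>W. norm x = 1 \<and> (\<exists>l. A *v x = l *\<^sub>R x)"
proof -
  have ne': "w /\<^sub>R norm w \<in> W \<inter> sphere 0 1" using ne W(1) by (simp add: subspace_scale)
  have comp: "compact (W \<inter> sphere 0 1)" using W(2) by (simp add: closed_Int_compact)
  have cont: "continuous_on (W \<inter> sphere 0 1) (\<lambda>x. x \<bullet> (A *v x))"
    by (intro continuous_intros linear_continuous_on linear_conv_bounded_linear[THEN iffD1] linear_mult_vec)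
  obtain x where x: "x \<in> W \<inter> sphere 0 1"
    and max: "\<And>y. y \<in> W \<inter> sphere 0 1 \<Longrightarrow> y \<bullet> (A *v y) \<le> x \<bullet> (A *v x)"
    using continuous_attains_sup[OF comp _ cont] ne' by blast
  define l where "l = x \<bullet> (A *v x)"
  have nx: "norm x = 1" and xW: "x \<in> W" using x by auto
  have ub: "y \<bullet> (A *v y) \<le> l * (y \<bullet> y)" if "y \<in> W" for y
  proof (cases "y = 0")
    case False
    have "y /\<^sub>R norm y \<in> W \<inter> sphere 0 1" using that False W(1) by (simp add: subspace_scale)
    from max[OF this] have "(y \<bullet> (A *v y)) / (norm y)\<^sup>2 \<le> l"
      by (simp add: l_def matrix_vector_mult_scaleR power2_eq_square field_simps)
    then show ?thesis using False by (simp add: field_simps power2_norm_eq_inner)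
  qed simp
  define z where "z = l *\<^sub>R x - A *v x"
  have zW: "z \<in> W" unfolding z_def using xW W by (simp add: subspace_scale subspace_diff)
  define b where "b = l * (z \<bullet> z) - z \<bullet> (A *v z)"
  have b0: "b \<ge> 0" unfolding b_def using ub[OF zW] by simp
  have quad: "0 \<le> 2 * e * (z \<bullet> z) + e\<^sup>2 * b" for e
  proof -
    have "x + e *\<^sub>R z \<in> W" using xW zW W(1) by (simp add: subspace_add subspace_scale)
    from ub[OF this] have
      "x \<bullet> (A *v x) + e * (x \<bullet> (A *v z)) + e * (z \<bullet> (A *v x)) + e\<^sup>2 * (z \<bullet> (A *v z))
        \<le> l * (x \<bullet> x + 2 * e * (x \<bullet> z) + e\<^sup>2 * (z \<bullet> z))"
      by (simp add: matrix_vector_right_distrib matrix_vector_mult_scaleR inner_add_left inner_add_right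
          inner_commute[of z x] algebra_simps power2_eq_square)
    moreover have "x \<bullet> (A *v z) = z \<bullet> (A *v x)"
      using hermitian_inner[OF A, of x z] by (simp add: inner_commute)
    moreover have "x \<bullet> x = 1" using nx by (simp add: norm_eq_1)
    moreover have "2 * e * (z \<bullet> z) = 2 * e * (l * (x \<bullet> z)) - 2 * e * (z \<bullet> (A *v x))"
    proof -
      have "z \<bullet> z = z \<bullet> (l *\<^sub>R x - A *v x)" by (simp add: z_def)
      also have "\<dots> = l * (x \<bullet> z) - z \<bullet> (A *v x)"
        by (simp add: inner_diff_right inner_commute[of z x])
      finally show ?thesis by (simp only: right_diff_distrib)
    qed
    ultimately show ?thesis by (simp add: b_def l_def[symmetric] algebra_simps)
  qed
  have "z \<bullet> z = 0"
  proof (rule ccontr)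
    assume "z \<bullet> z \<noteq> 0"
    then have a: "z \<bullet> z > 0" by simp
    \<comment> \<open>a step so short that the linear term of the quadratic outweighs the square term\<close>
    define e where "e = - (z \<bullet> z) / (b + 1)"
    have e: "e < 0" "e * (b + 1) = - (z \<bullet> z)" using a b0 by (auto simp: e_def field_simps)
    have "2 * e * (z \<bullet> z) + e\<^sup>2 * b = e * (2 * (z \<bullet> z) + e * b)" by (simp add: algebra_simps power2_eq_square)
    also have "2 * (z \<bullet> z) + e * b = z \<bullet> z - e" using e(2) by (simp add: algebra_simps)
    also have "e * (z \<bullet> z - e) < 0" using e(1) a by (intro mult_neg_pos) linarith+
    finally show False using quad[of e] by simp
  qed
  then have "A *v x = l *\<^sub>R x" by (simp add: z_def)
  then show ?thesis using xW nx by blast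
qed

text \<open>
  One eigenvector at a time: the orthogonal complement of the eigenvectors found so far is invariant
  under \<open>A\<close>. Indexing the vectors by a growing subset \<open>I\<close> of the index type lets the final family
  be the columns of a square matrix.
\<close>

lemma hermitian_orthonormal_eigenvectors:
  fixes A :: "complex^'n^'n" and I :: "'n set"
  assumes A: "hermitian A"
  shows "\<exists>u d. (\<forall>i\<in>I. A *v u i = d i *\<^sub>R u i) \<and> (\<forall>i\<in>I. \<forall>j\<in>I. cinner (u i) (u j) = (if i = j then 1 else 0))"
  using finite[of I]
proof (induction I rule: finite_induct)
  case (insert k I)
  then obtain u d where u: "\<And>i. i \<in> I \<Longrightarrow> A *v u i = d i *\<^sub>R u i"
    "\<And>i j. i \<in> I \<Longrightarrow> j \<in> I \<Longrightarrow> cinner (u i) (u j) = (if i = j then 1 else 0)" by blast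
  define W where "W = {w. \<forall>i\<in>I. cinner (u i) w = 0}"
  have "subspace W"
    by (auto simp: subspace_def W_def cinner_add_right cinner_scaleR_right) (simp add: cinner_def)
  moreover have "closed W"
  proof -
    have "W = (\<Inter>i\<in>I. {w. cinner (u i) w = 0})" by (auto simp: W_def)
    then show ?thesis
      by (auto intro!: closed_INT closed_Collect_eq continuous_on_cinner continuous_on_const)
  qed
  moreover have "A *v x \<in> W" if "x \<in> W" for x
    using that u(1) A by (simp add: W_def cinner_cadjoint hermitian_def cinner_scaleR_left)
  moreover obtain w where "w \<in> W" "w \<noteq> 0"
    using exists_orthogonal_vector[OF insert.hyps(2), of u] by (auto simp: W_def)
  ultimately obtain x l where x: "x \<in> W" "norm x = 1" "A *v x = l *\<^sub>R x"
    using hermitian_max_eigenvector[OF A] by metis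
  have "cinner x (u i) = 0" if "i \<in> I" for i
    using x(1) that cinner_commute[of x "u i"] by (simp add: W_def)
  then have "(\<forall>i\<in>insert k I. A *v (u(k := x)) i = (d(k := l)) i *\<^sub>R (u(k := x)) i) \<and>
    (\<forall>i\<in>insert k I. \<forall>j\<in>insert k I. cinner ((u(k := x)) i) ((u(k := x)) j) = (if i = j then 1 else 0))"
    using insert.hyps(2) x u by (auto simp: W_def cinner_self[of x])
  then show ?case by blast
qed simp

lemma spectral_theorem:
  fixes A :: "complex^'n^'n"
  assumes "hermitian A"
  shows "\<exists>U d. unitary U \<and> A = udiag U d"
proof -
  obtain u :: "'n \<Rightarrow> complex^'n" and d where u: "\<And>i. A *v u i = d i *\<^sub>R u i"
    "\<And>i j. cinner (u i) (u j) = (if i = j then 1 else 0)"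
    using hermitian_orthonormal_eigenvectors[OF assms, of UNIV] by (metis UNIV_I)
  define U :: "complex^'n^'n" where "U = (\<chi> i j. u j $ i)"
  have "cadjoint U ** U = mat 1"
    using u(2) by (simp add: vec_eq_iff U_def cadjoint_def matrix_matrix_mult_def mat_def cinner_def)
  then have U: "unitary U" using matrix_left_right_inverse[of U "cadjoint U"] by (simp add: unitary_def)
  have "A ** U = U ** real_diag d"
  proof -
    have "(A ** U) $ i $ j = (A *v u j) $ i" for i j
      by (simp add: U_def matrix_matrix_mult_def matrix_vector_mult_def)
    then show ?thesis
      by (simp add: vec_eq_iff mult_real_diag_nth u(1)) (simp add: U_def scaleR_conv_of_real)
  qed
  then have "A ** U ** cadjoint U = udiag U d" by (simp add: udiag_def)
  then have "A = udiag U d" using U by (simp add: unitary_cancel matrix_mul_assoc[symmetric])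
  then show ?thesis using U by blast
qed

section \<open>Real powers of positive definite matrices\<close>

lemma posdef_hermitian: "A \<in> posdef \<Longrightarrow> hermitian A"
  by (simp add: posdef_def)

lemma posdef_diagonalize:
  assumes "A \<in> posdef"
  obtains U d where "unitary U" "\<And>i. d i > 0" "A = udiag U d"
    "\<And>r. mpow A r = udiag U (\<lambda>i. d i powr r)"
proof -
  obtain U d where "unitary U" "A = udiag U d"
    using spectral_theorem[of A] assms by (auto simp: posdef_def)
  then show ?thesis using that[of U d] assms posdef_udiag_iff[of U d]
    by (simp add: mpow_def matrix_fun_udiag)
qed

lemma mpow_posdef: "A \<in> posdef \<Longrightarrow> mpow A r \<in> posdef"
  by (erule posdef_diagonalize) (simp add: posdef_udiag_iff, metis less_irrefl)

lemma mpow_add: "A \<in> posdef \<Longrightarrow> mpow A r ** mpow A s = mpow A (r + s)"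
  by (erule posdef_diagonalize) (simp add: udiag_mult powr_add)

lemma mpow_0:
  assumes "A \<in> posdef" shows "mpow A 0 = mat 1"
proof (rule posdef_diagonalize[OF assms])
  fix U d assume *: "unitary U" "\<And>i. (d i :: real) > 0" "\<And>r. mpow A r = udiag U (\<lambda>i. d i powr r)"
  have "d i powr 0 = 1" for i using *(2)[of i] by simp
  then show ?thesis by (simp only: *(3) udiag_1[OF *(1)])
qed

lemma mpow_1: "A \<in> posdef \<Longrightarrow> mpow A 1 = A"
  by (erule posdef_diagonalize) (simp add: less_imp_le)

lemma mpow_mpow: "A \<in> posdef \<Longrightarrow> mpow (mpow A r) s = mpow A (r * s)"
  by (erule posdef_diagonalize) (simp add: mpow_def matrix_fun_udiag powr_powr)

lemma mpow_neg_cancel: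
  assumes "A \<in> posdef"
  shows "mpow A r ** mpow A (- r) = mat 1" "mpow A (- r) ** mpow A r = mat 1"
  by (simp_all add: assms mpow_add mpow_0)

lemma matrix_inv_unique:
  fixes A :: "'a::field^'n^'n"
  assumes "A ** B = mat 1" "B ** A = mat 1"
  shows "matrix_inv A = B"
proof -
  have "A ** matrix_inv A = mat 1 \<and> matrix_inv A ** A = mat 1"
    unfolding matrix_inv_def by (rule someI[of _ B]) (simp add: assms)
  then have "B ** (A ** matrix_inv A) = B" by simp
  then show ?thesis by (simp add: matrix_mul_assoc assms)
qed

lemma matrix_inv_posdef: "A \<in> posdef \<Longrightarrow> matrix_inv A = mpow A (-1)"
  using mpow_neg_cancel[of A 1] by (intro matrix_inv_unique) (simp_all add: mpow_1)

lemma posdef_congruence: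
  assumes "R \<in> posdef" "B \<in> posdef"
  shows "R ** B ** R \<in> posdef"
proof -
  have R: "cadjoint R = R" and B: "cadjoint B = B"
    using assms by (simp_all add: posdef_def hermitian_def)
  have "x \<bullet> (R ** B ** R *v x) > 0" if "x \<noteq> 0" for x
  proof -
    have "x \<bullet> (R *v x) > 0" using assms(1) that by (simp add: posdef_iff_inner)
    then have "R *v x \<noteq> 0" by auto
    then have "(R *v x) \<bullet> (B *v (R *v x)) > 0" using assms(2) by (simp add: posdef_iff_inner)
    then show ?thesis by (simp add: inner_cadjoint[of x R] R flip: matrix_vector_mul_assoc)
  qed
  then show ?thesis
    by (simp add: posdef_iff_inner hermitian_def cadjoint_mult R B matrix_mul_assoc)
qed

section \<open>Nonnegativity and the equality case\<close>

text \<open>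
  Cyclicity of the trace merges the two outer square roots in \<open>F\<^sub>t(A, B)\<close>, and then the two outer factors
  \<open>A^(-1/2)\<close> of \<open>A^(-1) \<sharp>\<^sub>t B\<close> with \<open>A^(2 - 2t)\<close>. In what remains
  of that trace, \<open>B\<close> occurs only inside one real power.
\<close>

lemma Phi_div_eq:
  assumes A: "A \<in> posdef" and B: "B \<in> posdef"
  shows "Phi_div t A B = (1 - t) * Re (trace A) + t * Re (trace B) -
    Re (trace (mpow A (1 - 2 * t) ** mpow (mpow A (1/2) ** B ** mpow A (1/2)) t))"
proof -
  let ?C = "mpow A (1/2) ** B ** mpow A (1/2)"
  define G where "G = mpow A (-1/2) ** mpow ?C t ** mpow A (-1/2)"
  have geo: "geo_mean t (matrix_inv A) B = G"
    using A by (simp add: geo_mean_def G_def matrix_inv_posdef mpow_mpow)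
  have G: "G \<in> posdef"
    unfolding G_def using A B by (intro posdef_congruence mpow_posdef)
  have "trace (F_mean t A B) = trace (mpow G (1/2) ** (mpow G (1/2) ** mpow A (2 - 2 * t)))"
    unfolding F_mean_def geo by (rule trace_mul_sym)
  also have "\<dots> = trace (G ** mpow A (2 - 2 * t))"
    using G by (simp add: matrix_mul_assoc mpow_add mpow_1)
  also have "\<dots> = trace (mpow A (-1/2) ** (mpow ?C t ** (mpow A (-1/2) ** mpow A (2 - 2 * t))))"
    by (simp only: G_def matrix_mul_assoc)
  also have "\<dots> = trace ((mpow ?C t ** (mpow A (-1/2) ** mpow A (2 - 2 * t))) ** mpow A (-1/2))"
    by (rule trace_mul_sym)
  also have "\<dots> = trace (mpow ?C t ** mpow A (1 - 2 * t))"
    using A by (simp add: matrix_mul_assoc[symmetric] mpow_add)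
  also have "\<dots> = trace (mpow A (1 - 2 * t) ** mpow ?C t)"
    by (rule trace_mul_sym)
  finally have F: "trace (F_mean t A B) = \<dots>" .
  have "trace (arith_mean t A B) = (1 - t) *\<^sub>R trace A + t *\<^sub>R trace B"
    by (simp add: arith_mean_def trace_def sum.distrib scaleR_sum_right)
  then show ?thesis
    by (simp add: Phi_div_def trace_sub F)
qed

text \<open>
  Dividing by the arithmetic mean \<open>m\<close> reduces both parts to \<open>ln z \<le> z - 1\<close>, applied to \<open>x / m\<close> and \<open>y / m\<close>,
  whose right-hand sides average to 0. Equality forces \<open>z = 1\<close> in both places, that is, \<open>x = m = y\<close>.
\<close>

lemma Young_powr:
  fixes x y t :: real
  assumes "x > 0" "y > 0" "0 \<le> t" "t \<le> 1"
  shows "x powr (1 - t) * y powr t \<le> (1 - t) * x + t * y"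
    and "0 < t \<Longrightarrow> t < 1 \<Longrightarrow> x powr (1 - t) * y powr t = (1 - t) * x + t * y \<Longrightarrow> x = y"
proof -
  define m where "m = (1 - t) * x + t * y"
  have m: "m > 0"
    using assms unfolding m_def
    by (cases "t = 0") (auto intro!: add_nonneg_pos)
  have le: "ln (z / m) \<le> z / m - 1" if "z > 0" for z
    using that m ln_le_minus_one[of "z / m"] by simp
  have ln: "ln (x powr (1 - t) * y powr t) - ln m = (1 - t) * ln (x / m) + t * ln (y / m)"
    using assms m by (simp add: ln_mult ln_powr ln_div algebra_simps)
  have sum0: "(1 - t) * (x / m - 1) + t * (y / m - 1) = 0"
    using m by (simp add: m_def field_simps)
  have "(1 - t) * ln (x / m) + t * ln (y / m) \<le> (1 - t) * (x / m - 1) + t * (y / m - 1)"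
    using assms le by (intro add_mono mult_left_mono) auto
  then have "ln (x powr (1 - t) * y powr t) \<le> ln m" using ln sum0 by simp
  then show "x powr (1 - t) * y powr t \<le> (1 - t) * x + t * y"
    using assms m unfolding m_def[symmetric] by (simp add: mult_pos_pos)
  assume t: "0 < t" "t < 1" and eq: "x powr (1 - t) * y powr t = (1 - t) * x + t * y"
  have "(1 - t) * ln (x / m) + t * ln (y / m) = 0" using ln eq by (simp add: m_def)
  then have "(1 - t) * (x / m - 1 - ln (x / m)) + t * (y / m - 1 - ln (y / m)) = 0"
    using sum0 by (simp add: algebra_simps)
  moreover have "0 \<le> (1 - t) * (x / m - 1 - ln (x / m))" "0 \<le> t * (y / m - 1 - ln (y / m))"
    using le assms by simp_all
  ultimately have "(1 - t) * (x / m - 1 - ln (x / m)) = 0" "t * (y / m - 1 - ln (y / m)) = 0"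
    by linarith+
  then have "ln (x / m) = x / m - 1" "ln (y / m) = y / m - 1" using t by auto
  then have "x / m = 1" "y / m = 1" using ln_eq_minus_one[of "x / m"] ln_eq_minus_one[of "y / m"] m assms by simp_all
  then show "x = y" using m by (simp add: field_simps)
qed

text \<open>
  All three traces are expanded over the same weights. The trace of \<open>B\<close> takes part because it equals
  the trace of \<open>A^(-1) C\<close>. The exponents are arranged so that each summand is the defect in
  Young's inequality for the numbers \<open>a\<^sub>i\<close> and \<open>c\<^sub>j / a\<^sub>i\<close>.
\<close>

lemma Phi_div_expansion:
  fixes A B :: "complex^'n^'n"
  assumes A: "A \<in> posdef" and B: "B \<in> posdef"
  obtains U V :: "complex^'n^'n" and a c :: "'n \<Rightarrow> real"
  where "unitary U" "unitary V" "\<And>i. a i > 0" "\<And>j. c j > 0"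
    "A ** A = udiag U (\<lambda>i. a i * a i)" "mpow A (1/2) ** B ** mpow A (1/2) = udiag V c"
    "\<And>t. Phi_div t A B = (\<Sum>i\<in>UNIV. \<Sum>j\<in>UNIV.
      ((1 - t) * a i + t * (c j / a i) - a i powr (1 - t) * (c j / a i) powr t) *
      (norm ((cadjoint U ** V) $ i $ j))\<^sup>2)"
proof -
  define C where "C = mpow A (1/2) ** B ** mpow A (1/2)"
  have C: "C \<in> posdef" unfolding C_def using A B by (intro posdef_congruence mpow_posdef)
  obtain U a where U: "unitary U" "\<And>i. a i > 0" "A = udiag U a"
    "\<And>r. mpow A r = udiag U (\<lambda>i. a i powr r)" using posdef_diagonalize[OF A] by metis
  obtain V c where V: "unitary V" "\<And>i. c i > 0" "C = udiag V c"
    "\<And>r. mpow C r = udiag V (\<lambda>i. c i powr r)" using posdef_diagonalize[OF C] by metis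
  let ?p = "\<lambda>i j. (norm ((cadjoint U ** V) $ i $ j))\<^sup>2"
  have "Phi_div t A B = (\<Sum>i\<in>UNIV. \<Sum>j\<in>UNIV.
      ((1 - t) * a i + t * (c j / a i) - a i powr (1 - t) * (c j / a i) powr t) * ?p i j)" for t
  proof -
    have "trace A = trace (udiag U a ** udiag V (\<lambda>j. 1))" by (simp add: U(3) V(1) udiag_1)
    then have trA: "Re (trace A) = (\<Sum>i\<in>UNIV. \<Sum>j\<in>UNIV. a i * ?p i j)"
      by (simp add: trace_udiag_mult U(1) V(1))
    have "trace (mpow A (-1) ** C) = trace (mpow A (-1) ** (mpow A (1/2) ** B ** mpow A (1/2)))"
      by (simp only: C_def)
    also have "\<dots> = trace ((mpow A (-1) ** (mpow A (1/2) ** B)) ** mpow A (1/2))"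
      by (simp only: matrix_mul_assoc)
    also have "\<dots> = trace (mpow A (1/2) ** (mpow A (-1) ** (mpow A (1/2) ** B)))"
      by (rule trace_mul_sym)
    also have "\<dots> = trace B" using A by (simp add: matrix_mul_assoc mpow_add mpow_0)
    finally have "trace B = trace (udiag U (\<lambda>i. a i powr -1) ** udiag V c)"
      by (simp add: U(4) V(3))
    then have trB: "Re (trace B) = (\<Sum>i\<in>UNIV. \<Sum>j\<in>UNIV. a i powr -1 * c j * ?p i j)"
      by (simp add: trace_udiag_mult U(1) V(1))
    have trF: "Re (trace (mpow A (1 - 2 * t) ** mpow C t)) =
        (\<Sum>i\<in>UNIV. \<Sum>j\<in>UNIV. a i powr (1 - 2 * t) * c j powr t * ?p i j)"
      by (simp add: U(4) V(4) trace_udiag_mult U(1) V(1))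
    have summand: "a i powr -1 * c j = c j / a i"
      "a i powr (1 - 2 * t) * c j powr t = a i powr (1 - t) * (c j / a i) powr t" for i j
    proof -
      show "a i powr -1 * c j = c j / a i"
        using U(2)[of i] by (simp add: powr_minus field_simps)
      have "a i powr (1 - 2 * t) = a i powr (1 - t) * a i powr (- t)"
        by (simp flip: powr_add)
      then show "a i powr (1 - 2 * t) * c j powr t = a i powr (1 - t) * (c j / a i) powr t"
        using U(2)[of i] V(2)[of j] by (simp add: powr_divide powr_minus field_simps)
    qed
    show ?thesis
      unfolding Phi_div_eq[OF A B] C_def[symmetric] trA trB trF summand
      by (simp add: sum_distrib_left sum.distrib[symmetric] sum_subtractf[symmetric] algebra_simps)
  qed
  moreover have "A ** A = udiag U (\<lambda>i. a i * a i)" by (simp add: U(3) udiag_mult U(1))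
  ultimately show ?thesis using that U(1,2) V(1,2) V(3)[unfolded C_def] by blast
qed

lemma Phi_div_nonneg:
  fixes A B :: "complex^'n^'n"
  assumes A: "A \<in> posdef" and B: "B \<in> posdef" and t: "0 \<le> t" "t \<le> 1"
  shows "Phi_div t A B \<ge> 0"
proof -
  obtain U V :: "complex^'n^'n" and a c :: "'n \<Rightarrow> real" where *: "\<And>i. a i > 0" "\<And>j. c j > (0::real)"
    "\<And>t. Phi_div t A B = (\<Sum>i\<in>UNIV. \<Sum>j\<in>UNIV.
      ((1 - t) * a i + t * (c j / a i) - a i powr (1 - t) * (c j / a i) powr t) *
      (norm ((cadjoint U ** V) $ i $ j))\<^sup>2)"
    by (rule Phi_div_expansion[OF A B]) blast
  have "a i powr (1 - t) * (c j / a i) powr t \<le> (1 - t) * a i + t * (c j / a i)" for i j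
    using * t by (intro Young_powr(1)) auto
  then show ?thesis unfolding *(3)
    by (intro sum_nonneg mult_nonneg_nonneg zero_le_power2) (simp only: diff_ge_0_iff_ge)
qed

lemma Phi_div_self:
  assumes A: "A \<in> posdef" shows "Phi_div t A A = 0"
proof -
  have "mpow A (1/2) ** A ** mpow A (1/2) = mpow A (1/2) ** mpow A 1 ** mpow A (1/2)"
    using A by (simp add: mpow_1)
  also have "\<dots> = mpow A 2" using A by (simp add: mpow_add)
  finally show ?thesis
    using A by (simp add: Phi_div_eq mpow_mpow mpow_add mpow_1 algebra_simps)
qed

text \<open>
  A sum of nonnegative terms vanishes only if every term does. By the equality case of Young's inequality
  \<open>a\<^sub>i\<^sup>2 = c\<^sub>j\<close> wherever the weight is nonzero, and this is the criterion for \<open>A^2 = A^(1/2) B A^(1/2)\<close>.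
\<close>

lemma Phi_div_eq_0_imp:
  fixes A B :: "complex^'n^'n"
  assumes A: "A \<in> posdef" and B: "B \<in> posdef" and t: "0 < t" "t < 1" and 0: "Phi_div t A B = 0"
  shows "A = B"
proof -
  obtain U V :: "complex^'n^'n" and a c :: "'n \<Rightarrow> real" where UV: "unitary U" "unitary V" and pos: "\<And>i. a i > 0" "\<And>j. c j > (0::real)"
    and AA: "A ** A = udiag U (\<lambda>i. a i * a i)"
    and C: "mpow A (1/2) ** B ** mpow A (1/2) = udiag V c"
    and Phi: "\<And>t. Phi_div t A B = (\<Sum>i\<in>UNIV. \<Sum>j\<in>UNIV.
      ((1 - t) * a i + t * (c j / a i) - a i powr (1 - t) * (c j / a i) powr t) *
      (norm ((cadjoint U ** V) $ i $ j))\<^sup>2)"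
    by (rule Phi_div_expansion[OF A B]) blast
  define s where "s i j = ((1 - t) * a i + t * (c j / a i) - a i powr (1 - t) * (c j / a i) powr t) *
      (norm ((cadjoint U ** V) $ i $ j))\<^sup>2" for i j
  have "a i powr (1 - t) * (c j / a i) powr t \<le> (1 - t) * a i + t * (c j / a i)" for i j
    using pos t by (intro Young_powr(1)) auto
  then have nn: "s i j \<ge> 0" for i j
    unfolding s_def by (intro mult_nonneg_nonneg zero_le_power2) (simp only: diff_ge_0_iff_ge)
  have z: "s i j = 0" for i j
  proof -
    have "(\<Sum>i\<in>UNIV. \<Sum>j\<in>UNIV. s i j) = 0" using 0 Phi[of t] by (simp only: s_def)
    then have "(\<Sum>j\<in>UNIV. s i j) = 0"
      by (subst (asm) sum_nonneg_eq_0_iff) (auto intro!: sum_nonneg nn)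
    then show ?thesis
      by (subst (asm) sum_nonneg_eq_0_iff) (auto intro!: nn)
  qed
  have "a i * a i = c j" if "(cadjoint U ** V) $ i $ j \<noteq> 0" for i j
  proof -
    have eq: "a i powr (1 - t) * (c j / a i) powr t = (1 - t) * a i + t * (c j / a i)"
      using z[of i j] that by (simp add: s_def)
    have "a i = c j / a i"
      by (rule Young_powr(2)[OF pos(1) divide_pos_pos[OF pos(2) pos(1)]
            less_imp_le[OF t(1)] less_imp_le[OF t(2)] t eq])
    then show ?thesis using pos(1)[of i] by (simp add: field_simps)
  qed
  then have "A ** A = mpow A (1/2) ** B ** mpow A (1/2)"
    unfolding AA C by (simp add: udiag_eq_iff UV)
  then have "mpow A (-(1/2)) ** (A ** A) ** mpow A (-(1/2)) =
      (mpow A (-(1/2)) ** mpow A (1/2)) ** B ** (mpow A (1/2) ** mpow A (-(1/2)))"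
    by (simp only: matrix_mul_assoc)
  also have "\<dots> = B" by (simp only: mpow_neg_cancel[OF A]) simp
  also have "mpow A (-(1/2)) ** (A ** A) ** mpow A (-(1/2)) =
    mpow A (-(1/2)) ** (mpow A 1 ** mpow A 1) ** mpow A (-(1/2))" using A by (simp add: mpow_1)
  also have "\<dots> = A" using A by (simp only: mpow_add) (simp add: mpow_1)
  finally show ?thesis .
qed

section \<open>Twice differentiable dependence of real powers on the matrix\<close>

lemma norm_mult_vec_le: "norm ((A :: complex^'n^'m) *v x) \<le> norm A * norm x"
proof -
  have "norm ((A *v x) $ i) \<le> norm (A $ i) * norm x" for i
  proof -
    have "norm ((A *v x) $ i) \<le> (\<Sum>j\<in>UNIV. \<bar>norm (A $ i $ j)\<bar> * \<bar>norm (x $ j)\<bar>)"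
      unfolding matrix_vector_mult_def by (simp add: sum_norm_le norm_mult)
    also have "\<dots> \<le> norm (A $ i) * norm x"
      unfolding norm_vec_def[of x] norm_vec_def[of "A $ i"] by (rule L2_set_mult_ineq)
    finally show ?thesis .
  qed
  then have "norm (A *v x) \<le> L2_set (\<lambda>i. norm (A $ i) * norm x) UNIV"
    unfolding norm_vec_def[of "A *v x"] by (intro L2_set_mono) auto
  also have "\<dots> = norm A * norm x"
    by (simp add: norm_vec_def[of A] L2_set_left_distrib)
  finally show ?thesis .
qed

lemma bounded_bilinear_mult_vec: "bounded_bilinear ((*v) :: complex^'n^'m \<Rightarrow> _)"
proof
  show "\<exists>K. \<forall>(A :: complex^'n^'m) x. norm (A *v x) \<le> norm A * norm x * K"
    by (rule exI[of _ 1]) (simp add: norm_mult_vec_le)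
qed (simp_all add: matrix_vector_mult_add_rdistrib matrix_vector_right_distrib
    scaleR_matrix_vector_mult matrix_vector_mult_scaleR)

interpretation mult_vec: bounded_bilinear "(*v) :: complex^'n^'m \<Rightarrow> _"
  by (rule bounded_bilinear_mult_vec)

text \<open>
  The powers of \<open>X\<close> applied to a fixed vector, and their first and second derivatives in \<open>X\<close> in the directions
  \<open>H\<close> and \<open>L\<close>. The recursions are the product rule for \<open>X * X^k\<close>. Acting on a vector keeps all estimates in terms
  of \<open>|X v| \<le> \<rho> |v|\<close>, a bound on the operator norm of \<open>X\<close>; the Euclidean norm of \<open>X\<close> as an array
  of entries can exceed 1 for matrices at which the series converges.
\<close>

primrec pow_vec :: "nat \<Rightarrow> complex^'n^'n \<Rightarrow> complex^'n \<Rightarrow> complex^'n" where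
  "pow_vec 0 X v = v"
| "pow_vec (Suc k) X v = X *v pow_vec k X v"

primrec dpow_vec :: "nat \<Rightarrow> complex^'n^'n \<Rightarrow> complex^'n^'n \<Rightarrow> complex^'n \<Rightarrow> complex^'n" where
  "dpow_vec 0 X H v = 0"
| "dpow_vec (Suc k) X H v = X *v dpow_vec k X H v + H *v pow_vec k X v"

primrec ddpow_vec :: "nat \<Rightarrow> complex^'n^'n \<Rightarrow> complex^'n^'n \<Rightarrow> complex^'n^'n \<Rightarrow> complex^'n \<Rightarrow> complex^'n"
  where
  "ddpow_vec 0 X H L v = 0"
| "ddpow_vec (Suc k) X H L v =
    X *v ddpow_vec k X H L v + L *v dpow_vec k X H v + H *v dpow_vec k X L v"

lemma has_derivative_pow_vec:
  "((\<lambda>X. pow_vec k X v) has_derivative (\<lambda>H. dpow_vec k X H v)) (at X)"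
proof (induction k)
  case (Suc k)
  show ?case using mult_vec.FDERIV[OF has_derivative_ident Suc] by simp
qed simp

lemma has_derivative_dpow_vec:
  "((\<lambda>X. dpow_vec k X H v) has_derivative (\<lambda>L. ddpow_vec k X H L v)) (at X)"
proof (induction k)
  case (Suc k)
  show ?case
    using has_derivative_add[OF mult_vec.FDERIV[OF has_derivative_ident Suc]
        bounded_linear.has_derivative[OF mult_vec.bounded_linear_right[of H] has_derivative_pow_vec[of k v X]]]
    by simp
qed simp

context
  fixes X :: "complex^'n^'n" and \<rho> :: real
  assumes X: "\<And>v. norm (X *v v) \<le> \<rho> * norm v" and \<rho>: "\<rho> \<ge> 0"
begin

lemma norm_pow_vec_le: "norm (pow_vec k X v) \<le> \<rho> ^ k * norm v"
proof (induction k)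
  case (Suc k)
  have "norm (X *v pow_vec k X v) \<le> \<rho> * norm (pow_vec k X v)" by (rule X)
  also have "\<dots> \<le> \<rho> * (\<rho> ^ k * norm v)" using Suc \<rho> by (rule mult_left_mono)
  finally show ?case by (simp add: mult.assoc)
qed simp

text \<open>
  The bounds have the form of the derivatives of \<open>\<rho>^k\<close>. They are multiplied by \<open>\<rho>\<close> (below by \<open>\<rho>\<^sup>2\<close>) so that no exponents
  \<open>k - 1\<close> or \<open>k - 2\<close> occur; for the second derivative \<open>k\<^sup>2\<close> replaces \<open>k (k - 1)\<close>.
\<close>

lemma norm_dpow_vec_le: "\<rho> * norm (dpow_vec k X H v) \<le> real k * \<rho> ^ k * norm v * norm H"
proof (induction k)
  case (Suc k)
  have "norm (dpow_vec (Suc k) X H v) \<le> norm (X *v dpow_vec k X H v) + norm (H *v pow_vec k X v)"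
    by (simp add: norm_triangle_ineq)
  also have "\<dots> \<le> \<rho> * norm (dpow_vec k X H v) + norm H * (\<rho> ^ k * norm v)"
    by (intro add_mono X order_trans[OF norm_mult_vec_le] mult_left_mono norm_pow_vec_le norm_ge_zero)
  also have "\<dots> \<le> real k * \<rho> ^ k * norm v * norm H + norm H * (\<rho> ^ k * norm v)"
    by (intro add_mono Suc order_refl)
  also have "\<dots> = real (Suc k) * \<rho> ^ k * norm v * norm H" by (simp add: algebra_simps)
  finally show ?case using \<rho> mult_left_mono by (fastforce simp: algebra_simps)
qed simp

lemma norm_ddpow_vec_le:
  "\<rho>\<^sup>2 * norm (ddpow_vec k X H L v) \<le> (real k)\<^sup>2 * \<rho> ^ k * norm v * norm H * norm L"
proof (induction k)
  case (Suc k)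
  have "norm (ddpow_vec (Suc k) X H L v) \<le>
      norm (X *v ddpow_vec k X H L v) + norm (L *v dpow_vec k X H v) + norm (H *v dpow_vec k X L v)"
    by (simp add: norm_triangle_le norm_triangle_ineq add_mono)
  also have "\<dots> \<le> \<rho> * norm (ddpow_vec k X H L v) + norm L * norm (dpow_vec k X H v)
      + norm H * norm (dpow_vec k X L v)"
    by (intro add_mono X norm_mult_vec_le)
  finally have "\<rho>\<^sup>2 * norm (ddpow_vec (Suc k) X H L v) \<le>
    \<rho>\<^sup>2 * (\<rho> * norm (ddpow_vec k X H L v) + norm L * norm (dpow_vec k X H v)
      + norm H * norm (dpow_vec k X L v))"
    by (rule mult_left_mono) simp
  also have "\<dots> = \<rho> * (\<rho>\<^sup>2 * norm (ddpow_vec k X H L v)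
      + norm L * (\<rho> * norm (dpow_vec k X H v)) + norm H * (\<rho> * norm (dpow_vec k X L v)))"
    by (simp add: algebra_simps power2_eq_square)
  also have "\<dots> \<le> \<rho> * ((real k)\<^sup>2 * \<rho> ^ k * norm v * norm H * norm L
      + norm L * (real k * \<rho> ^ k * norm v * norm H) + norm H * (real k * \<rho> ^ k * norm v * norm L))"
    by (intro mult_left_mono add_mono Suc norm_dpow_vec_le \<rho> norm_ge_zero)
  also have "\<dots> = ((real k)\<^sup>2 + 2 * real k) * (\<rho> ^ Suc k * norm v * norm H * norm L)"
    by (simp add: algebra_simps power2_eq_square)
  also have "\<dots> \<le> (real (Suc k))\<^sup>2 * (\<rho> ^ Suc k * norm v * norm H * norm L)"
    using \<rho> by (intro mult_right_mono) (simp_all add: power2_eq_square algebra_simps)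
  finally show ?case by (simp add: mult.assoc)
qed simp

end

text \<open>
  Weierstrass criterion: derivatives dominated by a summable sequence, uniformly on \<open>S\<close>, have
  uniformly small tails, which is what differentiation term by term requires.
\<close>

lemma has_derivative_suminf:
  fixes f :: "nat \<Rightarrow> 'a::real_normed_vector \<Rightarrow> 'b::banach"
  assumes S: "open S" "convex S" "x \<in> S"
    and deriv: "\<And>n x. x \<in> S \<Longrightarrow> (f n has_derivative f' n x) (at x)"
    and bound: "\<And>n x h. x \<in> S \<Longrightarrow> norm (f' n x h) \<le> c n * norm h"
    and c: "summable c"
    and sf: "\<And>x. x \<in> S \<Longrightarrow> summable (\<lambda>n. f n x)"
  shows "((\<lambda>x. \<Sum>n. f n x) has_derivative (\<lambda>h. \<Sum>n. f' n x h)) (at x)"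
proof -
  have "\<exists>g. \<forall>x\<in>S. (\<lambda>n. f n x) sums g x \<and> (g has_derivative (\<lambda>h. \<Sum>n. f' n x h)) (at x within S)"
  proof (rule has_derivative_series[OF S(2) _ _ S(3)])
    fix e :: real assume "e > 0"
    then obtain N where N: "\<And>n. n \<ge> N \<Longrightarrow> norm (\<Sum>i. c (i + n)) < e"
      using suminf_exist_split[OF _ c] by blast
    have "norm (sum (\<lambda>i. f' i x h) {..<n} - (\<Sum>n. f' n x h)) \<le> e * norm h" if "n \<ge> N" "x \<in> S" for n x h
    proof -
      have sc: "summable (\<lambda>i. c i * norm h)" using c by (rule summable_mult2)
      have s': "summable (\<lambda>i. f' i x h)"
        using bound[OF that(2)] by (intro summable_comparison_test[OF _ sc]) auto
      have "(\<Sum>n. f' n x h) - sum (\<lambda>i. f' i x h) {..<n} = (\<Sum>i. f' (i + n) x h)"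
        using suminf_split_initial_segment[OF s', of n] by simp
      then have "norm (sum (\<lambda>i. f' i x h) {..<n} - (\<Sum>n. f' n x h)) = norm (\<Sum>i. f' (i + n) x h)"
        by (metis norm_minus_commute)
      also have "\<dots> \<le> (\<Sum>i. c (i + n) * norm h)"
        by (intro norm_suminf_le bound[OF that(2)] summable_ignore_initial_segment[OF sc])
      also have "\<dots> = (\<Sum>i. c (i + n)) * norm h"
        by (rule suminf_mult2[symmetric]) (rule summable_ignore_initial_segment[OF c])
      also have "\<dots> \<le> e * norm h" using N[OF that(1)] by (intro mult_right_mono) auto
      finally show ?thesis .
    qed
    then show "\<forall>\<^sub>F n in sequentially. \<forall>x\<in>S. \<forall>h.
        norm (sum (\<lambda>i. f' i x h) {..<n} - (\<Sum>n. f' n x h)) \<le> e * norm h"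
      unfolding eventually_sequentially by blast
  qed (auto intro: has_derivative_at_withinI deriv summable_sums sf S(3))
  then obtain g where
    "\<forall>x\<in>S. (\<lambda>n. f n x) sums g x \<and> (g has_derivative (\<lambda>h. \<Sum>n. f' n x h)) (at x within S)"
    by (rule exE)
  then have g: "\<And>x. x \<in> S \<Longrightarrow> (\<lambda>n. f n x) sums g x"
    "(g has_derivative (\<lambda>h. \<Sum>n. f' n x h)) (at x within S)"
    using S(3) by simp_all
  have "(g has_derivative (\<lambda>h. \<Sum>n. f' n x h)) (at x)"
    using g(2) by (simp only: at_within_open[OF S(3,1)])
  then show ?thesis
    by (rule has_derivative_transform_within_open[OF _ S(1,3)]) (rule sums_unique[OF g(1)])
qed

lemma summable_square_geometric:
  fixes \<rho> :: real
  assumes "0 < \<rho>" "\<rho> < 1"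
  shows "summable (\<lambda>k. (real k)\<^sup>2 * \<rho> ^ k)"
proof -
  have 1: "summable (\<lambda>n. diffs (\<lambda>_. 1) n * x ^ n)" if "norm x < 1" for x :: real
    using that by (intro termdiff_converges[of x 1]) (auto intro: summable_geometric)
  have 2: "summable (\<lambda>n. diffs (diffs (\<lambda>_. 1)) n * \<rho> ^ n)"
    using assms by (intro termdiff_converges[of \<rho> 1 "diffs (\<lambda>_. 1)"]) (auto intro: 1)
  show ?thesis
  proof (rule summable_comparison_test[OF _ 2], intro exI allI impI)
    fix n :: nat
    show "norm ((real n)\<^sup>2 * \<rho> ^ n) \<le> diffs (diffs (\<lambda>_. 1)) n * \<rho> ^ n"
      using assms by (simp add: diffs_def power2_eq_square mult_mono)
  qed
qed

context
  fixes a :: "nat \<Rightarrow> real" and S :: "(complex^'n^'n) set" and \<rho> :: real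
  assumes a: "\<And>k. \<bar>a k\<bar> \<le> 1" and S: "open S" "convex S" and \<rho>: "0 < \<rho>" "\<rho> < 1"
    and contr: "\<And>X v. X \<in> S \<Longrightarrow> norm (X *v v) \<le> \<rho> * norm v"
begin

lemma norm_scaleR_coeff_le: "norm (a k *\<^sub>R x) \<le> norm x"
  using a[of k] by (simp add: mult_left_le_one_le)

lemma norm_dpow_vec_coeff_le:
  assumes "X \<in> S"
  shows "norm (a k *\<^sub>R dpow_vec k X H v) \<le> ((real k)\<^sup>2 * \<rho> ^ k) * (norm v / \<rho>) * norm H"
proof -
  have "\<rho> * norm (a k *\<^sub>R dpow_vec k X H v) \<le> \<rho> * norm (dpow_vec k X H v)"
    using \<rho> by (intro mult_left_mono norm_scaleR_coeff_le) simp
  also have "\<dots> \<le> real k * (\<rho> ^ k * norm v * norm H)"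
    using norm_dpow_vec_le[OF contr[OF assms], of k H v] \<rho> by (simp add: mult.assoc)
  also have "\<dots> \<le> (real k)\<^sup>2 * (\<rho> ^ k * norm v * norm H)"
    using \<rho> by (intro mult_right_mono) (cases k; simp add: power2_eq_square)+
  finally show ?thesis using \<rho> by (simp add: field_simps)
qed

lemma norm_ddpow_vec_coeff_le:
  assumes "X \<in> S"
  shows "norm (a k *\<^sub>R ddpow_vec k X H L v) \<le> ((real k)\<^sup>2 * \<rho> ^ k) * (norm v * norm H / \<rho>\<^sup>2) * norm L"
proof -
  have "\<rho>\<^sup>2 * norm (a k *\<^sub>R ddpow_vec k X H L v) \<le> \<rho>\<^sup>2 * norm (ddpow_vec k X H L v)"
    using \<rho> by (intro mult_left_mono norm_scaleR_coeff_le) simp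
  also have "\<dots> \<le> (real k)\<^sup>2 * \<rho> ^ k * norm v * norm H * norm L"
    using norm_ddpow_vec_le[OF contr[OF assms], of k H L v] \<rho> by simp
  finally show ?thesis using \<rho> by (simp add: field_simps)
qed

lemma has_derivative_pow_series:
  assumes "X \<in> S"
  shows "((\<lambda>X. \<Sum>k. a k *\<^sub>R pow_vec k X v) has_derivative (\<lambda>H. \<Sum>k. a k *\<^sub>R dpow_vec k X H v)) (at X)"
proof (rule has_derivative_suminf[OF S assms])
  show "((\<lambda>X. a k *\<^sub>R pow_vec k X v) has_derivative (\<lambda>H. a k *\<^sub>R dpow_vec k X H v)) (at X)" for k X
    by (intro has_derivative_scaleR_right has_derivative_pow_vec)
  show "summable (\<lambda>k. (real k)\<^sup>2 * \<rho> ^ k * (norm v / \<rho>))"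
    by (intro summable_mult2 summable_square_geometric \<rho>)
  show "summable (\<lambda>k. a k *\<^sub>R pow_vec k X v)" if "X \<in> S" for X
  proof (rule summable_comparison_test)
    show "\<exists>N. \<forall>k\<ge>N. norm (a k *\<^sub>R pow_vec k X v) \<le> \<rho> ^ k * norm v"
      using norm_scaleR_coeff_le norm_pow_vec_le[OF contr[OF that]] \<rho>
      by (meson less_imp_le order_trans)
    show "summable (\<lambda>k. \<rho> ^ k * norm v)"
      using \<rho> by (intro summable_mult2 summable_geometric) simp
  qed
qed (rule norm_dpow_vec_coeff_le)

lemma has_derivative_dpow_series:
  assumes "X \<in> S"
  shows "((\<lambda>X. \<Sum>k. a k *\<^sub>R dpow_vec k X H v) has_derivative (\<lambda>L. \<Sum>k. a k *\<^sub>R ddpow_vec k X H L v)) (at X)"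
proof (rule has_derivative_suminf[OF S assms])
  show "((\<lambda>X. a k *\<^sub>R dpow_vec k X H v) has_derivative (\<lambda>L. a k *\<^sub>R ddpow_vec k X H L v)) (at X)" for k X
    by (intro has_derivative_scaleR_right has_derivative_dpow_vec)
  show "summable (\<lambda>k. (real k)\<^sup>2 * \<rho> ^ k * (norm v * norm H / \<rho>\<^sup>2))"
    by (intro summable_mult2 summable_square_geometric \<rho>)
  show "summable (\<lambda>k. a k *\<^sub>R dpow_vec k X H v)" if "X \<in> S" for X
  proof (rule summable_comparison_test)
    show "\<exists>N. \<forall>k\<ge>N. norm (a k *\<^sub>R dpow_vec k X H v) \<le> ((real k)\<^sup>2 * \<rho> ^ k) * (norm v / \<rho>) * norm H"
      using norm_dpow_vec_coeff_le[OF that] by blast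
    show "summable (\<lambda>k. ((real k)\<^sup>2 * \<rho> ^ k) * (norm v / \<rho>) * norm H)"
      by (intro summable_mult2 summable_square_geometric \<rho>)
  qed
qed (rule norm_ddpow_vec_coeff_le)

end

text \<open>
  The factor from one coefficient to the next is \<open>(t - k) / (k + 1)\<close>, of modulus at most 1.
\<close>

lemma abs_gbinomial_le_1:
  fixes t :: real
  assumes "0 \<le> t" "t \<le> 1"
  shows "\<bar>t gchoose k\<bar> \<le> 1"
proof (induction k)
  case (Suc k)
  have "real (Suc k) * (t gchoose Suc k) = (t - real k) * (t gchoose k)"
    using gbinomial_mult_1[of t k] by (simp add: algebra_simps)
  then have "real (Suc k) * \<bar>t gchoose Suc k\<bar> = \<bar>t - real k\<bar> * \<bar>t gchoose k\<bar>"
    by (metis abs_mult abs_of_nat)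
  also have "\<dots> \<le> real (Suc k) * 1"
    using Suc assms by (intro mult_mono) auto
  finally show ?case by (simp del: of_nat_Suc)
qed simp

lemma udiag_mult_vec:
  fixes U :: "complex^'n^'n"
  shows "udiag U d *v v = (\<Sum>i\<in>UNIV. d i *\<^sub>R (U *v axis i ((cadjoint U *v v) $ i)))"
proof -
  have "real_diag d *v y = (\<Sum>i\<in>UNIV. d i *\<^sub>R axis i (y $ i))" for y :: "complex^'n"
  proof -
    have "(\<Sum>i\<in>UNIV. d i *\<^sub>R axis i (y $ i)) $ k = (\<Sum>i\<in>UNIV. if i = k then of_real (d k) * y $ k else 0)" for k
      unfolding sum_component by (rule sum.cong) (auto simp: axis_def complex_eq_iff)
    then show ?thesis by (simp add: vec_eq_iff real_diag_mult_vec_nth)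
  qed
  then show ?thesis
    by (simp add: udiag_def mult_vec.sum_right matrix_vector_mult_scaleR flip: matrix_vector_mul_assoc)
qed

lemma pow_vec_udiag: "unitary U \<Longrightarrow> pow_vec k (udiag U x) v = udiag U (\<lambda>i. x i ^ k) *v v"
  by (induction k) (simp_all add: udiag_1 matrix_vector_mul_assoc udiag_mult)

text \<open>
  In the eigenbasis this is the scalar binomial series for each eigenvalue.
\<close>

lemma binomial_series_udiag:
  assumes U: "unitary U" and x: "\<And>i. \<bar>x i\<bar> < 1"
  shows "(\<Sum>k. (t gchoose k) *\<^sub>R pow_vec k (udiag U x) v) = udiag U (\<lambda>i. (1 + x i) powr t) *v v"
proof -
  let ?e = "\<lambda>i. U *v axis i ((cadjoint U *v v) $ i)"
  have "(\<lambda>k. \<Sum>i\<in>UNIV. ((t gchoose k) * x i ^ k) *\<^sub>R ?e i) sums (\<Sum>i\<in>UNIV. ((1 + x i) powr t) *\<^sub>R ?e i)"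
    using x by (intro sums_sum sums_scaleR_left gen_binomial_real)
  then have "(\<lambda>k. (t gchoose k) *\<^sub>R pow_vec k (udiag U x) v) sums (udiag U (\<lambda>i. (1 + x i) powr t) *v v)"
    by (simp add: pow_vec_udiag[OF U] udiag_mult_vec scaleR_sum_right)
  then show ?thesis by (simp add: sums_iff)
qed

lemma norm_udiag_mult_vec_le:
  assumes U: "unitary U" and x: "\<And>i. \<bar>x i\<bar> \<le> r"
  shows "norm (udiag U x *v v) \<le> r * norm v"
proof -
  have r: "r \<ge> 0" using x abs_ge_zero order_trans by blast
  let ?y = "cadjoint U *v v"
  have "norm (udiag U x *v v) = norm (cadjoint U *v (udiag U x *v v))"
    by (simp add: norm_unitary U)
  also have "cadjoint U *v (udiag U x *v v) = real_diag x *v ?y"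
    by (simp add: udiag_def matrix_vector_mul_assoc matrix_mul_assoc unitary_cancel U)
  also have "norm (real_diag x *v ?y) \<le> L2_set (\<lambda>i. r * norm (?y $ i)) UNIV"
    unfolding norm_vec_def[of "real_diag x *v ?y"]
    by (intro L2_set_mono) (auto simp: real_diag_mult_vec_nth norm_mult intro!: mult_right_mono x)
  also have "\<dots> = r * norm ?y"
    using r by (simp add: norm_vec_def[of ?y] L2_set_right_distrib)
  finally show ?thesis by (simp add: norm_unitary U)
qed

text \<open>
  Write \<open>C^t = s^t (1 + X)^t\<close> with \<open>X = C / s - 1\<close>, where \<open>s\<close> is the trace of the centre \<open>C\<^sub>0\<close>. The eigenvalues of
  \<open>C\<^sub>0 / s\<close> lie in \<open>(0, 1]\<close>, so at the centre \<open>X\<close> has operator norm at most some \<open>r < 1\<close>, and on a small ball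
  around it at most \<open>\<rho> < 1\<close>. There the binomial series converges and is differentiable twice. The functions \<open>f v\<close>,
  being defined by the series, are differentiable in all matrix directions, not only the Hermitian ones, and
  agree with \<open>C^t v\<close> at the positive definite matrices \<open>C\<close> near \<open>C\<^sub>0\<close>.
\<close>

lemma mpow_locally_twice_differentiable:
  fixes C0 :: "complex^'n^'n"
  assumes C0: "C0 \<in> posdef" and t: "0 \<le> t" "t \<le> 1"
  obtains N and f :: "complex^'n \<Rightarrow> complex^'n^'n \<Rightarrow> complex^'n"
    and f' :: "complex^'n \<Rightarrow> complex^'n^'n \<Rightarrow> complex^'n^'n \<Rightarrow> complex^'n"
    and f'' :: "complex^'n \<Rightarrow> complex^'n^'n \<Rightarrow> complex^'n^'n \<Rightarrow> complex^'n"
  where "open N" "C0 \<in> N"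
    "\<And>C v. C \<in> posdef \<Longrightarrow> C \<in> N \<Longrightarrow> mpow C t *v v = f v C"
    "\<And>C v. C \<in> N \<Longrightarrow> (f v has_derivative f' v C) (at C)"
    "\<And>v H. ((\<lambda>C. f' v C H) has_derivative f'' v H) (at C0)"
proof -
  obtain U d where U: "unitary U" "\<And>i. d i > 0" "C0 = udiag U d"
    using posdef_diagonalize[OF C0] by metis
  define s where "s = (\<Sum>i\<in>UNIV. d i)"
  have ds: "d i \<le> s" for i unfolding s_def using U(2) by (intro member_le_sum) (auto intro: less_imp_le)
  then have s: "s > 0" using U(2) less_le_trans by blast
  define aff where "aff C = (1 / s) *\<^sub>R C - mat 1" for C :: "complex^'n^'n"
  have aff_udiag: "aff (udiag V c) = udiag V (\<lambda>i. c i / s - 1)" if "unitary V" for V c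
  proof -
    have "aff (udiag V c) = (1 / s) *\<^sub>R udiag V c - udiag V (\<lambda>i. 1)"
      by (simp add: aff_def udiag_1 that)
    then show ?thesis by (simp add: scaleR_udiag udiag_diff)
  qed
  define r where "r = Max (range (\<lambda>i. 1 - d i / s))"
  have r: "1 - d i / s \<le> r" for i unfolding r_def by (intro Max_ge) auto
  have "r \<in> range (\<lambda>i. 1 - d i / s)" unfolding r_def by (intro Max_in) auto
  then have r1: "r < 1" using U(2) s by auto
  have "0 \<le> 1 - d undefined / s" using ds[of undefined] s by simp
  then have r0: "0 \<le> r" using r[of undefined] by linarith
  have absr: "\<bar>d i / s - 1\<bar> \<le> r" for i
    using r[of i] ds[of i] s by (simp add: abs_le_iff)
  \<comment> \<open>half of the gap below 1 is spent on the radius of the ball, and the other half keeps \<open>\<rho>\<close> below 1\<close>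
  define \<epsilon> where "\<epsilon> = (1 - r) / 2"
  define \<rho> where "\<rho> = (1 + r) / 2"
  have \<rho>: "0 < \<rho>" "\<rho> < 1" and \<epsilon>: "\<epsilon> > 0" and sum: "r + \<epsilon> = \<rho>"
    using r0 r1 by (auto simp: \<rho>_def \<epsilon>_def field_simps)
  define S where "S = ball (aff C0) \<epsilon>"
  have contr: "norm (X *v v) \<le> \<rho> * norm v" if "X \<in> S" for X v
  proof -
    have "norm (X *v v) \<le> norm (aff C0 *v v) + norm ((X - aff C0) *v v)"
      by (metis mult_vec.diff_left norm_triangle_sub add.commute)
    also have "norm (aff C0 *v v) \<le> r * norm v"
      unfolding U(3) aff_udiag[OF U(1)] by (intro norm_udiag_mult_vec_le U(1) absr)
    also have "norm ((X - aff C0) *v v) \<le> \<epsilon> * norm v"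
      using that by (intro order_trans[OF norm_mult_vec_le] mult_right_mono)
        (auto simp: S_def dist_norm norm_minus_commute)
    finally show ?thesis by (simp add: sum[symmetric] algebra_simps)
  qed
  note series = has_derivative_pow_series[where a = "\<lambda>k. t gchoose k" and S = S, OF
      abs_gbinomial_le_1[OF t] _ _ \<rho> contr]
  note series' = has_derivative_dpow_series[where a = "\<lambda>k. t gchoose k" and S = S, OF
      abs_gbinomial_le_1[OF t] _ _ \<rho> contr]
  have S: "open S" "convex S" "aff C0 \<in> S" using \<epsilon> by (simp_all add: S_def)
  have daff: "(aff has_derivative (\<lambda>H. (1 / s) *\<^sub>R H)) (at C)" for C
    unfolding aff_def by (auto intro!: derivative_eq_intros)
  define f where "f v C = s powr t *\<^sub>R (\<Sum>k. (t gchoose k) *\<^sub>R pow_vec k (aff C) v)" for v C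
  define f' where "f' v C H = s powr t *\<^sub>R (\<Sum>k. (t gchoose k) *\<^sub>R dpow_vec k (aff C) ((1 / s) *\<^sub>R H) v)"
    for v C H
  define f'' where "f'' v H L =
    s powr t *\<^sub>R (\<Sum>k. (t gchoose k) *\<^sub>R ddpow_vec k (aff C0) ((1 / s) *\<^sub>R H) ((1 / s) *\<^sub>R L) v)" for v H L
  show ?thesis
  proof (rule that)
    have "continuous_on UNIV aff" unfolding aff_def by (intro continuous_intros)
    then show "open (aff -` S)" using S(1) by (simp add: open_vimage)
    show "C0 \<in> aff -` S" using S(3) by simp
  next
    fix C v assume C: "C \<in> posdef" "C \<in> aff -` S"
    obtain V c where V: "unitary V" "\<And>i. c i > 0" "C = udiag V c"
      "mpow C t = udiag V (\<lambda>i. c i powr t)" using posdef_diagonalize[OF C(1)] by metis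
    let ?x = "\<lambda>i. c i / s - 1"
    \<comment> \<open>the contraction bound, tested on eigenvectors, bounds the eigenvalues\<close>
    have x: "\<bar>?x i\<bar> < 1" for i
    proof -
      let ?v = "V *v axis i 1"
      have "cadjoint V *v ?v \<noteq> 0"
        using axis_eq_0_iff[of i "1::complex"] V(1) by (simp add: matrix_vector_mul_assoc unitary_cancel)
      then have v: "?v \<noteq> 0" by auto
      have "norm (aff C *v ?v) \<le> \<rho> * norm ?v" using C(2) by (intro contr) simp
      then have "\<bar>?x i\<bar> * norm ?v \<le> \<rho> * norm ?v"
        unfolding V(3) aff_udiag[OF V(1)] udiag_eigenvector[OF V(1)] by simp
      then show ?thesis using v \<rho>(2) by simp
    qed
    have "f v C = s powr t *\<^sub>R (udiag V (\<lambda>i. (1 + ?x i) powr t) *v v)"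
      unfolding f_def V(3) aff_udiag[OF V(1)] using x by (simp add: binomial_series_udiag V(1))
    also have "\<dots> = udiag V (\<lambda>i. s powr t * (1 + ?x i) powr t) *v v"
      by (simp add: udiag_mult_vec scaleR_sum_right)
    also have "(\<lambda>i. s powr t * (1 + ?x i) powr t) = (\<lambda>i. c i powr t)"
      using s V(2) by (simp add: less_imp_le flip: powr_mult)
    finally show "mpow C t *v v = f v C" by (simp add: V(4))
  next
    fix C v assume "C \<in> aff -` S"
    then have "((\<lambda>X. \<Sum>k. (t gchoose k) *\<^sub>R pow_vec k X v) has_derivative
      (\<lambda>H. \<Sum>k. (t gchoose k) *\<^sub>R dpow_vec k (aff C) H v)) (at (aff C))"
      by (intro series S) auto
    from has_derivative_compose[OF daff this] show "(f v has_derivative f' v C) (at C)"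
      unfolding f_def f'_def by (rule has_derivative_scaleR_right)
  next
    fix v H
    have "((\<lambda>X. \<Sum>k. (t gchoose k) *\<^sub>R dpow_vec k X ((1 / s) *\<^sub>R H) v) has_derivative
      (\<lambda>L. \<Sum>k. (t gchoose k) *\<^sub>R ddpow_vec k (aff C0) ((1 / s) *\<^sub>R H) L v)) (at (aff C0))"
      by (intro series' S) auto
    from has_derivative_compose[OF daff this] show "((\<lambda>C. f' v C H) has_derivative f'' v H) (at C0)"
      unfolding f'_def f''_def by (rule has_derivative_scaleR_right)
  qed
qed

section \<open>Second derivatives and necessary conditions for a minimum\<close>

text \<open>
  In finite dimension the map from points to derivatives is differentiable as soon as each partial
  derivative is: it is the finite sum of the partial derivatives times the coordinate functionals.
\<close>

lemma has_second_derivative_withinI: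
  fixes f :: "'a::euclidean_space \<Rightarrow> real"
  assumes N: "open N" "a \<in> N"
    and f': "\<And>x. x \<in> N \<Longrightarrow> (f has_derivative f' x) (at x)"
    and f'': "\<And>h. ((\<lambda>x. f' x h) has_derivative f'' h) (at a)"
  shows "\<exists>D2. has_second_derivative_within f D2 a UNIV"
proof -
  define D where "D x = (\<Sum>b\<in>Basis. f' x b *\<^sub>R blinfun_inner_right b)" for x
  have D: "blinfun_apply (D x) = f' x" if "x \<in> N" for x
  proof
    fix h
    have lin: "linear (f' x)" using f'[OF that] has_derivative_linear by blast
    have "f' x h = f' x (\<Sum>b\<in>Basis. (h \<bullet> b) *\<^sub>R b)" by (simp add: euclidean_representation)
    also have "\<dots> = (\<Sum>b\<in>Basis. (h \<bullet> b) * f' x b)"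
      using lin by (simp add: linear_sum linear_cmul)
    finally show "blinfun_apply (D x) h = f' x h"
      by (simp add: D_def blinfun.sum_left blinfun.scaleR_left inner_commute mult.commute)
  qed
  define E where "E h = (\<Sum>b\<in>Basis. f'' b h *\<^sub>R blinfun_inner_right b)" for h
  have DE: "(D has_derivative E) (at a)"
    unfolding D_def E_def by (intro has_derivative_sum has_derivative_scaleR_left f'')
  then have "blinfun_apply (Blinfun E) = E"
    by (intro bounded_linear_Blinfun_apply has_derivative_bounded_linear)
  moreover have "\<forall>\<^sub>F x in nhds a. (f has_derivative blinfun_apply (D x)) (at x)"
    using eventually_nhds_in_open[OF N] by eventually_elim (simp add: D f')
  ultimately show ?thesis using DE unfolding has_second_derivative_within_def
    by (intro exI[of _ "Blinfun E"] exI[of _ D]) simp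
qed

lemma has_second_derivative_within_transform:
  assumes f: "has_second_derivative_within f D2 a UNIV"
    and N: "open N" "a \<in> N" and eq: "\<And>x. x \<in> S \<Longrightarrow> x \<in> N \<Longrightarrow> g x = f x"
  shows "has_second_derivative_within g D2 a S"
proof -
  obtain D where D: "\<forall>\<^sub>F x in nhds a. (f has_derivative blinfun_apply (D x)) (at x)"
    "(D has_derivative blinfun_apply D2) (at a)"
    using f unfolding has_second_derivative_within_def by auto
  have "\<forall>\<^sub>F x in nhds a. x \<in> S \<longrightarrow> (g has_derivative blinfun_apply (D x)) (at x within S)"
    using D(1) eventually_nhds_in_open[OF N]
  proof eventually_elim
    case (elim x)
    show ?case
    proof
      assume x: "x \<in> S"
      obtain e where e: "e > 0" "ball x e \<subseteq> N" using N(1) elim(2) openE by blast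
      show "(g has_derivative blinfun_apply (D x)) (at x within S)"
        by (rule has_derivative_transform_within[OF has_derivative_at_withinI[OF elim(1)] e(1) x])
          (rule eq[symmetric], assumption, use e(2) in \<open>auto simp: subset_iff dist_commute\<close>)
    qed
  qed
  then show ?thesis
    using has_derivative_at_withinI[OF D(2), of S] unfolding has_second_derivative_within_def by blast
qed

text \<open>
  Along the line through \<open>a\<close> in the direction \<open>y\<close> this is the one-variable statement. If the second
  derivative were negative, the first derivative, being 0 at \<open>a\<close>, would be negative just after \<open>a\<close>, and the function
  would fall below its value at \<open>a\<close>.
\<close>

lemma second_order_necessary_conditions:
  fixes f :: "'a::real_normed_vector \<Rightarrow> real"
  assumes f: "has_second_derivative_within f D2 a UNIV"
    and min: "\<forall>\<^sub>F \<tau> in nhds (0::real). f a \<le> f (a + \<tau> *\<^sub>R y)"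
  shows "(f has_derivative f') (at a) \<Longrightarrow> f' y = 0"
    and "blinfun_apply (blinfun_apply D2 y) y \<ge> 0"
proof -
  obtain D where D: "\<forall>\<^sub>F x in nhds a. (f has_derivative blinfun_apply (D x)) (at x)"
    "(D has_derivative blinfun_apply D2) (at a)"
    using f unfolding has_second_derivative_within_def by auto
  define \<gamma> where "\<gamma> \<tau> = a + \<tau> *\<^sub>R y" for \<tau> :: real
  have \<gamma>0: "\<gamma> 0 = a" by (simp add: \<gamma>_def)
  have d\<gamma>: "(\<gamma> has_derivative (\<lambda>\<tau>. \<tau> *\<^sub>R y)) (at \<tau>)" for \<tau>
    unfolding \<gamma>_def by (auto intro!: derivative_eq_intros)
  have "filterlim \<gamma> (nhds a) (nhds 0)"
    using has_derivative_continuous[OF d\<gamma>[of 0]] unfolding isCont_def tendsto_nhds_iff \<gamma>0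
    by (simp add: tendsto_nhds_iff \<gamma>0)
  then have "\<forall>\<^sub>F \<tau> in nhds 0. (f has_derivative blinfun_apply (D (\<gamma> \<tau>))) (at (\<gamma> \<tau>))"
    by (rule filterlim_iff[THEN iffD1, rule_format, OF _ D(1)])
  then have ev: "\<forall>\<^sub>F \<tau> in nhds 0. ((\<lambda>\<tau>. f (\<gamma> \<tau>)) has_real_derivative D (\<gamma> \<tau>) y) (at \<tau>)"
  proof eventually_elim
    case (elim \<tau>)
    from has_derivative_compose[OF d\<gamma> elim] show ?case
      by (rule has_derivative_imp_has_field_derivative) (simp add: blinfun.scaleR_right)
  qed
  obtain e where e: "e > 0" "\<And>\<tau>. \<bar>\<tau>\<bar> < e \<Longrightarrow> ((\<lambda>\<tau>. f (\<gamma> \<tau>)) has_real_derivative D (\<gamma> \<tau>) y) (at \<tau>)"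
    "\<And>\<tau>. \<bar>\<tau>\<bar> < e \<Longrightarrow> f a \<le> f (\<gamma> \<tau>)"
    using eventually_conj[OF ev min] unfolding eventually_nhds_metric \<gamma>_def dist_real_def by auto
  have D0: "D a y = 0"
    using DERIV_local_min[OF e(2)[of 0] e(1)] e(1,3) by (simp add: \<gamma>0)
  show "f' y = 0" if "(f has_derivative f') (at a)"
    using has_derivative_unique[OF that eventually_nhds_x_imp_x[OF D(1)]] D0 by simp
  have "((\<lambda>\<tau>. D (\<gamma> \<tau>)) has_derivative (\<lambda>\<tau>. D2 (\<tau> *\<^sub>R y))) (at 0)"
    by (rule has_derivative_compose[OF d\<gamma>]) (simp add: \<gamma>0 D(2))
  from bounded_linear.has_derivative[OF blinfun.bounded_linear_left[of y] this]
  have DD: "((\<lambda>\<tau>. D (\<gamma> \<tau>) y) has_real_derivative D2 y y) (at 0)"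
    by (rule has_derivative_imp_has_field_derivative) (simp add: blinfun.scaleR_right blinfun.scaleR_left)
  show "blinfun_apply (blinfun_apply D2 y) y \<ge> 0"
  proof (rule ccontr)
    assume "\<not> blinfun_apply (blinfun_apply D2 y) y \<ge> 0"
    then obtain d where d: "d > 0" "\<And>h. 0 < h \<Longrightarrow> h < d \<Longrightarrow> D (\<gamma> h) y < 0"
      using DERIV_neg_dec_right[OF DD] D0 by (auto simp: \<gamma>0 not_le)
    define h where "h = min d e / 2"
    have h: "0 < h" "h < d" "h < e" using d(1) e(1) by (auto simp: h_def)
    have "f (\<gamma> h) < f (\<gamma> 0)"
    proof (rule DERIV_neg_imp_decreasing_open[OF h(1)])
      show "\<exists>l. ((\<lambda>\<tau>. f (\<gamma> \<tau>)) has_real_derivative l) (at \<tau>) \<and> l < 0" if "0 < \<tau>" "\<tau> < h" for \<tau>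
        using that h by (intro exI[of _ "D (\<gamma> \<tau>) y"] conjI e(2) d(2)) auto
      show "continuous_on {0..h} (\<lambda>\<tau>. f (\<gamma> \<tau>))"
        using h by (intro continuous_at_imp_continuous_on ballI DERIV_isCont[OF e(2)]) auto
    qed
    moreover have "f a \<le> f (\<gamma> h)" using h by (intro e(3)) auto
    ultimately show False by (simp add: \<gamma>0)
  qed
qed

text \<open>
  A derivative within \<open>S\<close> is tested on increments \<open>x - a\<close> with \<open>x\<close> in \<open>S\<close> only. The positive definite matrices lie
  in the real subspace of Hermitian matrices, so a derivative there can be changed freely in
  directions outside that subspace.
\<close>

lemma has_derivative_within_cong_on_differences:
  assumes f: "(f has_derivative f') (at a within S)" and g: "bounded_linear g'"
    and eq: "\<And>x. x \<in> S \<Longrightarrow> g' (x - a) = f' (x - a)"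
  shows "(f has_derivative g') (at a within S)"
proof -
  have "((\<lambda>y. (1 / norm (y - a)) *\<^sub>R (f y - (f a + f' (y - a)))) \<longlongrightarrow> 0) (at a within S)"
    using f unfolding has_derivative_within by blast
  then have "((\<lambda>y. (1 / norm (y - a)) *\<^sub>R (f y - (f a + g' (y - a)))) \<longlongrightarrow> 0) (at a within S)"
    by (rule Lim_transform_eventually) (auto simp: eventually_at_topological eq)
  then show ?thesis using g unfolding has_derivative_within by blast
qed

section \<open>The divergence near the diagonal\<close>

text \<open>
  The quadratic form of \<open>A\<close> is at least \<open>m |x|\<^sup>2\<close>, with \<open>m > 0\<close> the least eigenvalue, and that of \<open>\<tau> Y\<close> is
  at most \<open>|\<tau>| |Y| |x|\<^sup>2\<close>.
\<close>

lemma eventually_posdef_add: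
  fixes A Y :: "complex^'n^'n"
  assumes A: "A \<in> posdef" and Y: "hermitian Y"
  shows "\<forall>\<^sub>F \<tau> in nhds (0::real). A + \<tau> *\<^sub>R Y \<in> posdef"
proof -
  obtain U d where U: "unitary U" "\<And>i. d i > 0" "A = udiag U d"
    using posdef_diagonalize[OF A] by metis
  define m where "m = Min (range d)"
  have "m \<in> range d" unfolding m_def by (intro Min_in) auto
  then have m: "m > 0" using U(2) by auto
  have md: "m \<le> d i" for i unfolding m_def by (intro Min_le) auto
  have low: "m * (norm x)\<^sup>2 \<le> x \<bullet> (A *v x)" for x
  proof -
    have "m * (norm x)\<^sup>2 = m * (norm (cadjoint U *v x))\<^sup>2" by (simp add: norm_unitary U(1))
    also have "\<dots> = (\<Sum>i\<in>UNIV. m * (norm ((cadjoint U *v x) $ i))\<^sup>2)"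
      by (simp add: norm_vec_def[of "cadjoint U *v x"] L2_set_def sum_nonneg sum_distrib_left)
    also have "\<dots> \<le> x \<bullet> (A *v x)"
      unfolding U(3) inner_udiag by (intro sum_mono mult_right_mono md) simp
    finally show ?thesis .
  qed
  have "((\<lambda>\<tau>::real. \<bar>\<tau>\<bar> * norm Y) \<longlongrightarrow> \<bar>0\<bar> * norm Y) (nhds 0)"
    by (intro tendsto_intros filterlim_ident)
  then have "\<forall>\<^sub>F \<tau> in nhds (0::real). \<bar>\<tau>\<bar> * norm Y < m"
    using m by (intro order_tendstoD(2)) auto
  then show ?thesis
  proof eventually_elim
    case (elim \<tau>)
    have "0 < x \<bullet> ((A + \<tau> *\<^sub>R Y) *v x)" if "x \<noteq> 0" for x
    proof -
      have "\<bar>x \<bullet> (Y *v x)\<bar> \<le> norm x * (norm Y * norm x)"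
        by (rule order_trans[OF Cauchy_Schwarz_ineq2]) (intro mult_left_mono norm_mult_vec_le norm_ge_zero)
      then have "\<bar>\<tau>\<bar> * \<bar>x \<bullet> (Y *v x)\<bar> \<le> \<bar>\<tau>\<bar> * (norm x * (norm Y * norm x))"
        by (intro mult_left_mono) auto
      also have "\<dots> = (\<bar>\<tau>\<bar> * norm Y) * (norm x)\<^sup>2" by (simp add: power2_eq_square)
      also have "\<dots> < m * (norm x)\<^sup>2" using elim that by (intro mult_strict_right_mono) auto
      finally have "\<bar>\<tau> * (x \<bullet> (Y *v x))\<bar> < x \<bullet> (A *v x)" using low[of x] by (simp add: abs_mult)
      then show ?thesis
        by (simp add: mult_vec.add_left scaleR_matrix_vector_mult inner_add_right)
    qed
    moreover have "hermitian (A + \<tau> *\<^sub>R Y)"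
      using Y posdef_hermitian[OF A] by (simp add: hermitian_def cadjoint_def vec_eq_iff)
    ultimately show ?case by (simp add: posdef_iff_inner)
  qed
qed

lemma matrix_vector_mult_axis: "(M *v axis j 1) $ i = (M :: complex^'n^'m) $ i $ j"
proof -
  have "(M *v axis j 1) $ i = (\<Sum>k\<in>UNIV. if k = j then M $ i $ j else 0)"
    unfolding matrix_vector_mult_def vec_lambda_beta by (rule sum.cong) (auto simp: axis_def)
  then show ?thesis by simp
qed

text \<open>
  With \<open>M = C^t\<close> this reduces the differentiability of the trace to that of \<open>C \<mapsto> C^t v\<close> for fixed vectors \<open>v\<close>.
\<close>

lemma Re_trace_mult:
  "Re (trace (K ** M)) = (\<Sum>j\<in>UNIV. (cadjoint K *v axis j 1) \<bullet> (M *v axis j 1))"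
proof -
  have "(cadjoint K *v axis j 1) \<bullet> (M *v axis j 1) = Re ((K ** M) $ j $ j)" for j
  proof -
    have "(cadjoint K *v axis j 1) \<bullet> (M *v axis j 1) = axis j 1 \<bullet> ((K ** M) *v axis j 1)"
      by (simp add: inner_cadjoint[of _ K] flip: matrix_vector_mul_assoc)
    also have "\<dots> = Re ((K ** M) $ j $ j)"
      by (simp add: inner_axis' matrix_vector_mult_axis)
    finally show ?thesis .
  qed
  then show ?thesis by (simp add: trace_def)
qed

lemma Phi_div_locally_twice_differentiable:
  fixes A :: "complex^'n^'n"
  assumes A: "A \<in> posdef" and t: "0 \<le> t" "t \<le> 1"
  obtains \<Psi> D2 N where "has_second_derivative_within \<Psi> D2 A UNIV" "open N" "A \<in> N"
    "\<And>B. B \<in> posdef \<Longrightarrow> B \<in> N \<Longrightarrow> Phi_div t A B = \<Psi> B"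
proof -
  define R where "R = mpow A (1/2)"
  define K where "K = mpow A (1 - 2 * t)"
  define T where "T B = R ** B ** R" for B
  have R: "R \<in> posdef" unfolding R_def by (rule mpow_posdef[OF A])
  have add_mult: "(X + Y) ** R = X ** R + Y ** R" for X Y
    by (simp add: matrix_matrix_mult_def vec_eq_iff ring_distribs sum.distrib)
  have T: "bounded_linear T"
    unfolding linear_conv_bounded_linear[symmetric] T_def
    by (intro linearI) (simp_all add: matrix_add_ldistrib add_mult matrix_scalar_ac
        flip: scalar_matrix_assoc)
  have tr: "bounded_linear (\<lambda>H :: complex^'n^'n. Re (trace H))"
    unfolding linear_conv_bounded_linear[symmetric]
    by (intro linearI) (simp_all add: trace_def sum.distrib sum_distrib_left)
  obtain N f f' f'' where N: "open N" "T A \<in> N"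
    and mp: "\<And>C v. C \<in> posdef \<Longrightarrow> C \<in> N \<Longrightarrow> mpow C t *v v = f v C"
    and f': "\<And>C v. C \<in> N \<Longrightarrow> (f v has_derivative f' v C) (at C)"
    and f'': "\<And>v H. ((\<lambda>C. f' v C H) has_derivative f'' v H) (at (T A))"
    using mpow_locally_twice_differentiable[OF posdef_congruence[OF R A] t] unfolding T_def by blast
  define w where "w j = cadjoint K *v axis j 1" for j
  define e :: "'n \<Rightarrow> complex^'n" where "e j = axis j 1" for j
  define \<Psi> where "\<Psi> B = (1 - t) * Re (trace A) + t * Re (trace B) -
    (\<Sum>j\<in>UNIV. w j \<bullet> f (e j) (T B))" for B
  have dT: "(T has_derivative T) (at B)" for B by (rule bounded_linear_imp_has_derivative[OF T])
  have "\<exists>D2. has_second_derivative_within \<Psi> D2 A UNIV"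
  proof (rule has_second_derivative_withinI)
    have "continuous_on UNIV T" using T by (rule linear_continuous_on)
    then show "open (T -` N)" using N(1) by (simp add: open_vimage)
    show "A \<in> T -` N" using N(2) by simp
    show "(\<Psi> has_derivative (\<lambda>H. t * Re (trace H) - (\<Sum>j\<in>UNIV. w j \<bullet> f' (e j) (T B) (T H)))) (at B)"
      if "B \<in> T -` N" for B
    proof -
      have "((\<lambda>B. f v (T B)) has_derivative (\<lambda>H. f' v (T B) (T H))) (at B)" for v
        using that by (intro has_derivative_compose[OF dT f']) simp
      then have "((\<lambda>B. \<Sum>j\<in>UNIV. w j \<bullet> f (e j) (T B)) has_derivative
          (\<lambda>H. \<Sum>j\<in>UNIV. w j \<bullet> f' (e j) (T B) (T H))) (at B)"
        by (intro has_derivative_sum has_derivative_inner_right)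
      moreover have "((\<lambda>B. (1 - t) * Re (trace A) + t * Re (trace B)) has_derivative
          (\<lambda>H. 0 + t * Re (trace H))) (at B)"
        by (intro has_derivative_add has_derivative_const has_derivative_mult_right
            bounded_linear_imp_has_derivative tr)
      ultimately show ?thesis
        unfolding \<Psi>_def by (auto dest: has_derivative_diff)
    qed
    show "((\<lambda>B. t * Re (trace H) - (\<Sum>j\<in>UNIV. w j \<bullet> f' (e j) (T B) (T H))) has_derivative
      (\<lambda>L. 0 - (\<Sum>j\<in>UNIV. w j \<bullet> f'' (e j) (T H) (T L)))) (at A)" for H
      by (intro has_derivative_diff has_derivative_const has_derivative_sum has_derivative_inner_right
          has_derivative_compose[OF dT f''])
  qed
  then obtain D2 where "has_second_derivative_within \<Psi> D2 A UNIV" by blast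
  moreover have "Phi_div t A B = \<Psi> B" if "B \<in> posdef" "B \<in> T -` N" for B
  proof -
    have "T B \<in> posdef" unfolding T_def using R that(1) by (rule posdef_congruence)
    then show ?thesis
      using mp[of "T B"] that(2)
      by (simp add: Phi_div_eq[OF A that(1)] \<Psi>_def Re_trace_mult w_def e_def K_def T_def R_def)
  qed
  moreover have "open (T -` N)"
    using N(1) linear_continuous_on[OF T, of UNIV] by (simp add: open_vimage)
  ultimately show ?thesis using that[of \<Psi> D2 "T -` N"] N(2) by simp
qed

text \<open>
  The necessary conditions are applied to the extension \<open>\<Psi>\<close>, which near \<open>A\<close> is differentiable in all directions. It has
  a minimum at \<open>A\<close> along every Hermitian direction, since nearby points in such a direction are
  positive definite and there \<open>\<Psi>\<close> is the nonnegative divergence.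
\<close>

lemma Phi_div_diag_derivatives:
  fixes A :: "complex^'n^'n"
  assumes A: "A \<in> posdef" and t: "0 \<le> t" "t \<le> 1"
  shows "(Phi_div t A has_derivative (\<lambda>_. 0)) (at A within posdef)"
    and "\<exists>D2. has_second_derivative_within (Phi_div t A) D2 A posdef \<and>
      (\<forall>Y. hermitian Y \<longrightarrow> blinfun_apply (blinfun_apply D2 Y) Y \<ge> 0)"
proof -
  obtain \<Psi> D2 N where \<Psi>: "has_second_derivative_within \<Psi> D2 A UNIV"
    and N: "open N" "A \<in> N" and eq: "\<And>B. B \<in> posdef \<Longrightarrow> B \<in> N \<Longrightarrow> Phi_div t A B = \<Psi> B"
    using Phi_div_locally_twice_differentiable[OF A t] by metis
  have min: "\<forall>\<^sub>F \<tau> in nhds (0::real). \<Psi> A \<le> \<Psi> (A + \<tau> *\<^sub>R Y)" if Y: "hermitian Y" for Y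
  proof -
    have "((\<lambda>\<tau>::real. A + \<tau> *\<^sub>R Y) \<longlongrightarrow> A + 0 *\<^sub>R Y) (nhds 0)"
      by (intro tendsto_intros filterlim_ident)
    then have "\<forall>\<^sub>F \<tau> in nhds (0::real). A + \<tau> *\<^sub>R Y \<in> N"
      using N by (intro topological_tendstoD) auto
    with eventually_posdef_add[OF A Y] show ?thesis
    proof eventually_elim
      case (elim \<tau>)
      then show ?case
        using eq[of A] eq[of "A + \<tau> *\<^sub>R Y"] A N(2) Phi_div_self[OF A, of t]
          Phi_div_nonneg[OF A elim(1) t] by simp
    qed
  qed
  obtain \<Psi>' where \<Psi>': "(\<Psi> has_derivative \<Psi>') (at A)"
    using \<Psi> unfolding has_second_derivative_within_def by (auto dest: eventually_nhds_x_imp_x)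
  obtain e where e: "e > 0" "ball A e \<subseteq> N" using N openE by blast
  have "(Phi_div t A has_derivative \<Psi>') (at A within posdef)"
    by (rule has_derivative_transform_within[OF has_derivative_at_withinI[OF \<Psi>'] e(1) A])
      (rule eq[symmetric], assumption, use e(2) in \<open>auto simp: subset_iff dist_commute\<close>)
  then show "(Phi_div t A has_derivative (\<lambda>_. 0)) (at A within posdef)"
  proof (rule has_derivative_within_cong_on_differences)
    fix B :: "complex^'n^'n" assume B: "B \<in> posdef"
    have "hermitian (B - A)"
      using posdef_hermitian[OF A] posdef_hermitian[OF B]
      by (simp add: hermitian_def cadjoint_def vec_eq_iff)
    then show "0 = \<Psi>' (B - A)"
      using second_order_necessary_conditions(1)[OF \<Psi> min \<Psi>'] by simp
  qed simp
  show "\<exists>D2. has_second_derivative_within (Phi_div t A) D2 A posdef \<and>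
      (\<forall>Y. hermitian Y \<longrightarrow> blinfun_apply (blinfun_apply D2 Y) Y \<ge> 0)"
    using has_second_derivative_within_transform[OF \<Psi> N eq] second_order_necessary_conditions(2)[OF \<Psi> min] by blast
qed

theorem theorem4p1:
  fixes t :: real and \<Phi> :: "complex^'n^'n \<Rightarrow> complex^'n^'n \<Rightarrow> real"
  assumes "0 \<le> t" and "t \<le> 1"
    and "\<Phi> = Phi_div t"
  shows "(0 < t \<and> t < 1 \<longrightarrow> quantum_divergence \<Phi>) \<and>
    (\<forall>A\<in>posdef. \<forall>B\<in>posdef. \<Phi> A B \<ge> 0 \<and> (A = B \<longrightarrow> \<Phi> A B = 0)) \<and>
    deriv_vanishes_diag \<Phi> \<and> second_deriv_nonneg_diag \<Phi>"
proof -
  have deriv: "deriv_vanishes_diag \<Phi>" "second_deriv_nonneg_diag \<Phi>"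
    using Phi_div_diag_derivatives[of _ t] assms
    unfolding deriv_vanishes_diag_def second_deriv_nonneg_diag_def by auto
  have nonneg: "\<forall>A\<in>posdef. \<forall>B\<in>posdef. \<Phi> A B \<ge> 0 \<and> (A = B \<longrightarrow> \<Phi> A B = 0)"
    using Phi_div_nonneg[of _ _ t] Phi_div_self assms by auto
  moreover have "separates_pos \<Phi>" if "0 < t" "t < 1"
    using nonneg Phi_div_eq_0_imp[of _ _ t] that assms(3) unfolding separates_pos_def by blast
  ultimately show ?thesis using deriv unfolding quantum_divergence_def by blast
qed

end
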